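(* Let $V$ be a complex vector space with $\dim V=k$ equipped with a nondegenerate symmetric bilinear form, and let $\mathrm{SO}(V)$ be its special orthogonal group. Then $$\dim(V^{\otimes n})^{\mathrm{SO}(V)}=\sum_{\substack{\mu\vdash n,\\ \ell(\mu)\le k,\\ \text{row lengths all even}\\ \text{or all odd}}}\#\mathrm{SYT}(\mu).$$
   Context: $\mu\vdash n$ means that $\mu$ is a partition of $n$; its parts are the row lengths of its Young diagram, and $\ell(\mu)$ is the number of parts of $\mu$. $\mathrm{SYT}(\mu)$ is the set of standard Young tableaux of shape $\mu$. $\mathrm{SO}(V)$ is the group of invertible linear operators on $V$ of determinant $1$ preserving the bilinear form, acting naturally on each tensor factor of $V^{\otimes n}$.
   Formalization: The parity condition is imposed on all k row lengths, with missing rows counted as 0 (even), so "all odd" requires exactly k parts; read on the positive parts only, the formula fails for k=2, n=1 (right side 1, left side 0). *)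

theory Defs
  imports
    Complex_Main
    "HOL-Library.FuncSet"
    "HOL-Library.Function_Algebras"
    "Jordan_Normal_Form.Determinant"
begin

section \<open>Determinant of an operator, special orthogonal group\<close>

definition ordered_basis :: "('a::field \<Rightarrow> 'v::ab_group_add \<Rightarrow> 'v) \<Rightarrow> 'v list \<Rightarrow> bool" where
  "ordered_basis scale bs \<longleftrightarrow>
     distinct bs \<and> \<not> module.dependent scale (set bs) \<and> module.span scale (set bs) = UNIV"

definition operator_matrix ::
  "('a::field \<Rightarrow> 'v::ab_group_add \<Rightarrow> 'v) \<Rightarrow> 'v list \<Rightarrow> ('v \<Rightarrow> 'v) \<Rightarrow> 'a mat" where
  "operator_matrix scale bs g = mat (length bs) (length bs)
     (\<lambda>(i, j). module.representation scale (set bs) (g (bs ! j)) (bs ! i))"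

text \<open>The basis chosen here does not matter, see \<open>operator_det_eq\<close> below.\<close>

definition operator_det ::
  "('a::field \<Rightarrow> 'v::ab_group_add \<Rightarrow> 'v) \<Rightarrow> ('v \<Rightarrow> 'v) \<Rightarrow> 'a" where
  "operator_det scale g = det (operator_matrix scale (SOME bs. ordered_basis scale bs) g)"

definition bilinear_form ::
  "('a::field \<Rightarrow> 'v::ab_group_add \<Rightarrow> 'v) \<Rightarrow> ('v \<Rightarrow> 'v \<Rightarrow> 'a) \<Rightarrow> bool" where
  "bilinear_form scale \<beta> \<longleftrightarrow>
     (\<forall>x. Vector_Spaces.linear scale (*) (\<lambda>y. \<beta> x y)) \<and>
     (\<forall>y. Vector_Spaces.linear scale (*) (\<lambda>x. \<beta> x y))"

definition symmetric_form :: "('v \<Rightarrow> 'v \<Rightarrow> 'a) \<Rightarrow> bool" where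
  "symmetric_form \<beta> \<longleftrightarrow> (\<forall>x y. \<beta> x y = \<beta> y x)"

definition nondegenerate_form :: "('v::zero \<Rightarrow> 'v \<Rightarrow> 'a::zero) \<Rightarrow> bool" where
  "nondegenerate_form \<beta> \<longleftrightarrow>
     (\<forall>x. (\<forall>y. \<beta> x y = 0) \<longrightarrow> x = 0) \<and> (\<forall>y. (\<forall>x. \<beta> x y = 0) \<longrightarrow> y = 0)"

definition special_orthogonal_group ::
  "('a::field \<Rightarrow> 'v::ab_group_add \<Rightarrow> 'v) \<Rightarrow> ('v \<Rightarrow> 'v \<Rightarrow> 'a) \<Rightarrow> ('v \<Rightarrow> 'v) set" where
  "special_orthogonal_group scale \<beta> =
     {g. Vector_Spaces.linear scale scale g \<and> bij g \<and>
         (\<forall>x y. \<beta> (g x) (g y) = \<beta> x y) \<and> operator_det scale g = 1}"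

section \<open>Tensor powers\<close>

text \<open>
  The \<open>n\<close>-th tensor power of \<open>V\<close> is realised inside the space of multilinear functions
  on \<open>n\<close>-tuples (lists of length \<open>n\<close>) of linear functionals on \<open>V\<close>: the pure tensor
  \<open>v\<^sub>1 \<otimes> \<dots> \<otimes> v\<^sub>n\<close> is the function \<open>(\<phi>\<^sub>1, \<dots>, \<phi>\<^sub>n) \<mapsto> \<phi>\<^sub>1 v\<^sub>1 \<cdots> \<phi>\<^sub>n v\<^sub>n\<close>, extended by \<open>0\<close> to lists that
  have the wrong length or contain a nonlinear function, and the tensor power is the linear
  span of the pure tensors. The lemmas \<open>multilinear_pure_tensor\<close> and
  \<open>tensor_power_universal\<close> below give its universal property.
\<close>

type_synonym ('v, 'a) tensor = "('v \<Rightarrow> 'a) list \<Rightarrow> 'a"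

definition tensor_scale :: "'a::field \<Rightarrow> ('v, 'a) tensor \<Rightarrow> ('v, 'a) tensor" where
  "tensor_scale c F = (\<lambda>\<phi>s. c * F \<phi>s)"

definition pure_tensor ::
  "('a::field \<Rightarrow> 'v::ab_group_add \<Rightarrow> 'v) \<Rightarrow> 'v list \<Rightarrow> ('v, 'a) tensor" where
  "pure_tensor scale vs = (\<lambda>\<phi>s.
     if length \<phi>s = length vs \<and> (\<forall>\<phi>\<in>set \<phi>s. Vector_Spaces.linear scale (*) \<phi>)
     then \<Prod>i<length vs. (\<phi>s ! i) (vs ! i) else 0)"

definition tensor_power ::
  "('a::field \<Rightarrow> 'v::ab_group_add \<Rightarrow> 'v) \<Rightarrow> nat \<Rightarrow> ('v, 'a) tensor set" where
  "tensor_power scale n = module.span tensor_scale {pure_tensor scale vs | vs. length vs = n}"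

text \<open>
  The operator induced by an invertible operator \<open>g\<close> on tensors; it sends
  \<open>v\<^sub>1 \<otimes> \<dots> \<otimes> v\<^sub>n\<close> to \<open>g v\<^sub>1 \<otimes> \<dots> \<otimes> g v\<^sub>n\<close>, see \<open>tensor_map_pure_tensor\<close>.
\<close>

definition tensor_map :: "('v \<Rightarrow> 'v) \<Rightarrow> ('v, 'a) tensor \<Rightarrow> ('v, 'a) tensor" where
  "tensor_map g F = (\<lambda>\<phi>s. F (map (\<lambda>\<phi>. \<phi> \<circ> g) \<phi>s))"

definition tensor_invariants ::
  "('a::field \<Rightarrow> 'v::ab_group_add \<Rightarrow> 'v) \<Rightarrow> ('v \<Rightarrow> 'v) set \<Rightarrow> nat \<Rightarrow> ('v, 'a) tensor set" where
  "tensor_invariants scale G n = {F \<in> tensor_power scale n. \<forall>g\<in>G. tensor_map g F = F}"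

section \<open>Partitions and standard Young tableaux\<close>

text \<open>A partition is the weakly decreasing list of its positive parts.\<close>

definition partition_of :: "nat \<Rightarrow> nat list \<Rightarrow> bool" where
  "partition_of n \<mu> \<longleftrightarrow> sorted_wrt (\<ge>) \<mu> \<and> (\<forall>p\<in>set \<mu>. 0 < p) \<and> sum_list \<mu> = n"

text \<open>Rows and columns are numbered from \<open>0\<close>; rows below the diagram have length \<open>0\<close>.\<close>

definition row_length :: "nat list \<Rightarrow> nat \<Rightarrow> nat" where
  "row_length \<mu> i = (if i < length \<mu> then \<mu> ! i else 0)"

text \<open>
  A diagram with at most \<open>k\<close> rows is regarded as having exactly the \<open>k\<close> row lengths
  \<open>\<mu>\<^sub>1 \<ge> \<dots> \<ge> \<mu>\<^sub>k \<ge> 0\<close>. So an empty row counts as even, and all rows being odd forces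
  exactly \<open>k\<close> parts.
\<close>

definition rows_same_parity :: "nat \<Rightarrow> nat list \<Rightarrow> bool" where
  "rows_same_parity k \<mu> \<longleftrightarrow>
     (\<forall>i<k. even (row_length \<mu> i)) \<or> (\<forall>i<k. odd (row_length \<mu> i))"

definition young_diagram :: "nat list \<Rightarrow> (nat \<times> nat) set" where
  "young_diagram \<mu> = {(i, j). j < row_length \<mu> i}"

text \<open>Tableaux are \<open>extensional\<close> so that distinct ones differ on the diagram.\<close>

definition SYT :: "nat list \<Rightarrow> (nat \<times> nat \<Rightarrow> nat) set" where
  "SYT \<mu> = {T \<in> extensional (young_diagram \<mu>).
     bij_betw T (young_diagram \<mu>) {1..sum_list \<mu>} \<and>
     (\<forall>i j j'. (i, j) \<in> young_diagram \<mu> \<and> (i, j') \<in> young_diagram \<mu> \<and> j < j'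
        \<longrightarrow> T (i, j) < T (i, j')) \<and>
     (\<forall>i i' j. (i, j) \<in> young_diagram \<mu> \<and> (i', j) \<in> young_diagram \<mu> \<and> i < i'
        \<longrightarrow> T (i, j) < T (i', j))}"

section \<open>Properties of the definitions\<close>

lemma vector_space_tensor_scale:
  "vector_space (tensor_scale :: 'a::field \<Rightarrow> ('v, 'a) tensor \<Rightarrow> ('v, 'a) tensor)"
  by unfold_locales (auto simp: tensor_scale_def fun_eq_iff algebra_simps)

lemma linear_tensor_map:
  "Vector_Spaces.linear tensor_scale tensor_scale
     (tensor_map g :: ('v, 'a::field) tensor \<Rightarrow> ('v, 'a) tensor)"
proof -
  interpret vector_space "tensor_scale :: 'a \<Rightarrow> ('v, 'a) tensor \<Rightarrow> ('v, 'a) tensor"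
    by (rule vector_space_tensor_scale)
  show ?thesis
    by unfold_locales (auto simp: tensor_map_def tensor_scale_def fun_eq_iff)
qed

lemma tensor_map_pure_tensor:
  fixes scale :: "'a::field \<Rightarrow> 'v::ab_group_add \<Rightarrow> 'v"
  assumes g: "Vector_Spaces.linear scale scale g" and bij: "bij g"
  shows "tensor_map g (pure_tensor scale vs) = pure_tensor scale (map g vs)"
proof
  fix \<phi>s :: "('v \<Rightarrow> 'a) list"
  interpret g: Vector_Spaces.linear scale scale g by (rule g)
  define h where "h = inv_into UNIV g"
  have gh: "g (h x) = x" for x
    using bij by (simp add: h_def bij_is_surj surj_f_inv_f)
  have inj: "x = y" if "g x = g y" for x y
    using bij that by (simp add: bij_def inj_eq)
  have h: "Vector_Spaces.linear scale scale h"
    by unfold_locales (rule inj, simp add: gh g.add g.scale)+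
  have iff: "Vector_Spaces.linear scale (*) (\<phi> \<circ> g) \<longleftrightarrow> Vector_Spaces.linear scale (*) \<phi>"
    for \<phi> :: "'v \<Rightarrow> 'a"
  proof
    assume "Vector_Spaces.linear scale (*) (\<phi> \<circ> g)"
    from Vector_Spaces.linear_compose[OF h this]
    show "Vector_Spaces.linear scale (*) \<phi>" by (simp add: comp_def gh)
  next
    assume "Vector_Spaces.linear scale (*) \<phi>"
    from Vector_Spaces.linear_compose[OF g this]
    show "Vector_Spaces.linear scale (*) (\<phi> \<circ> g)" .
  qed
  show "tensor_map g (pure_tensor scale vs) \<phi>s = pure_tensor scale (map g vs) \<phi>s"
    by (auto simp: tensor_map_def pure_tensor_def iff intro!: prod.cong)
qed

context vector_space
begin

lemma representation_sum_list:
  assumes "ordered_basis scale bs"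
  shows "v = (\<Sum>m<length bs. representation (set bs) v (bs ! m) *s bs ! m)"
proof -
  have "v = (\<Sum>b\<in>set bs. representation (set bs) v b *s b)"
    using assms by (intro sum_representation_eq[symmetric]) (auto simp: ordered_basis_def)
  also have "\<dots> = (\<Sum>m<length bs. representation (set bs) v (bs ! m) *s bs ! m)"
    using assms by (intro sum.reindex_bij_betw[symmetric] bij_betw_nth) (auto simp: ordered_basis_def)
  finally show ?thesis .
qed

lemma representation_compose:
  assumes b: "ordered_basis scale bs" and c: "ordered_basis scale cs"
    and f: "Vector_Spaces.linear scale scale f"
  shows "representation (set cs) (f v) u =
    (\<Sum>m<length bs. representation (set cs) (f (bs ! m)) u * representation (set bs) v (bs ! m))"
proof -
  interpret f: Vector_Spaces.linear scale scale f by (rule f)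
  have "f v = f (\<Sum>m<length bs. representation (set bs) v (bs ! m) *s bs ! m)"
    by (rule arg_cong[OF representation_sum_list[OF b]])
  also have "\<dots> = (\<Sum>m<length bs. representation (set bs) v (bs ! m) *s f (bs ! m))"
    by (simp add: f.sum f.scale)
  finally show ?thesis
    using c by (simp add: ordered_basis_def representation_sum representation_scale mult.commute)
qed

lemma length_ordered_basis:
  assumes "ordered_basis scale bs"
  shows "length bs = dim UNIV"
  using assms dim_eq_card[of "set bs" UNIV] by (simp add: ordered_basis_def distinct_card)

lemma det_operator_matrix_eq:
  assumes b: "ordered_basis scale bs" and c: "ordered_basis scale cs"
    and g: "Vector_Spaces.linear scale scale g"
  shows "det (operator_matrix scale bs g) = det (operator_matrix scale cs g)"
proof -
  define N where "N = length bs"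
  have N: "length bs = N" "length cs = N"
    using length_ordered_basis[OF b] length_ordered_basis[OF c] by (simp_all add: N_def)
  define M where "M ds es f = mat N N
    (\<lambda>(i, j). representation (set ds) (f (es ! j)) (ds ! i))" for ds es and f :: "'b \<Rightarrow> 'b"
  have M_carrier: "M ds es f \<in> carrier_mat N N" for ds es f
    by (simp add: M_def)
  have comp: "M ds es f1 * M es fs f2 = M ds fs (\<lambda>x. f1 (f2 x))"
    if "ordered_basis scale ds" "ordered_basis scale es" "length es = N"
      "Vector_Spaces.linear scale scale f1" for ds es fs f1 f2
  proof (rule eq_matI)
    fix i j assume "i < dim_row (M ds fs (\<lambda>x. f1 (f2 x)))" "j < dim_col (M ds fs (\<lambda>x. f1 (f2 x)))"
    then have "i < N" "j < N" by (simp_all add: M_def)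
    then show "(M ds es f1 * M es fs f2) $$ (i, j) = M ds fs (\<lambda>x. f1 (f2 x)) $$ (i, j)"
      using representation_compose[OF that(2,1,4), of "f2 (fs ! j)" "ds ! i"] that(3)
      by (simp add: M_def scalar_prod_def lessThan_atLeast0)
  qed (simp_all add: M_def)
  have id: "Vector_Spaces.linear scale scale (\<lambda>x. x)"
    by unfold_locales auto
  have one: "M ds ds (\<lambda>x. x) = 1\<^sub>m N" if "ordered_basis scale ds" "length ds = N" for ds
    using that by (intro eq_matI)
      (auto simp: M_def ordered_basis_def representation_basis nth_eq_iff_index_eq)
  let ?P = "M bs cs (\<lambda>x. x)" and ?Q = "M cs bs (\<lambda>x. x)"
  have PQ: "?P * ?Q = 1\<^sub>m N"
    using comp[OF b c N(2) id, of bs "\<lambda>x. x"] one[OF b N(1)] by simp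
  have QP: "?Q * ?P = 1\<^sub>m N"
    using comp[OF c b N(1) id, of cs "\<lambda>x. x"] one[OF c N(2)] by simp
  have PCQ: "M bs bs g = ?P * M cs cs g * ?Q"
    using comp[OF b c N(2) id, of cs g] comp[OF b c N(2) g, of bs "\<lambda>x. x"] by simp
  have "similar_mat (M bs bs g) (M cs cs g)"
    by (rule similar_matI[OF _ PQ QP PCQ]) (use M_carrier in auto)
  then show ?thesis
    using det_similar[of "M bs bs g" "M cs cs g"] by (simp add: operator_matrix_def M_def N)
qed

lemma operator_det_eq:
  assumes b: "ordered_basis scale bs" and g: "Vector_Spaces.linear scale scale g"
  shows "operator_det scale g = det (operator_matrix scale bs g)"
  unfolding operator_det_def using someI[of "ordered_basis scale", OF b] b g
  by (rule det_operator_matrix_eq)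

end

text \<open>Multilinearity of functions of \<open>n\<close> vectors, given as lists of length \<open>n\<close>.\<close>

definition multilinear ::
  "('a::field \<Rightarrow> 'v::ab_group_add \<Rightarrow> 'v) \<Rightarrow> ('a \<Rightarrow> 'w::ab_group_add \<Rightarrow> 'w) \<Rightarrow> nat
    \<Rightarrow> ('v list \<Rightarrow> 'w) \<Rightarrow> bool" where
  "multilinear s t n f \<longleftrightarrow>
     (\<forall>us ws. Suc (length us + length ws) = n \<longrightarrow> Vector_Spaces.linear s t (\<lambda>v. f (us @ v # ws)))"

lemma multilinear_pure_tensor:
  fixes scale :: "'a::field \<Rightarrow> 'v::ab_group_add \<Rightarrow> 'v"
  assumes "vector_space scale"
  shows "multilinear scale tensor_scale n (pure_tensor scale)"
proof -
  interpret V: vector_space scale by fact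
  interpret T: vector_space "tensor_scale :: 'a \<Rightarrow> ('v, 'a) tensor \<Rightarrow> ('v, 'a) tensor"
    by (rule vector_space_tensor_scale)
  have nth: "(us @ v # ws) ! i = (us @ 0 # ws) ! i" if "i \<noteq> length us"
    for us ws v and i :: nat
    using that by (cases "i - length us") (auto simp: nth_append)
  define c where "c \<phi>s us ws = (\<Prod>i\<in>{..<Suc (length us + length ws)} - {length us}.
    (\<phi>s ! i) ((us @ 0 # ws) ! i))" for \<phi>s :: "('v \<Rightarrow> 'a) list" and us ws
  have eq: "pure_tensor scale (us @ v # ws) \<phi>s =
    (if length \<phi>s = Suc (length us + length ws) \<and>
        (\<forall>\<phi>\<in>set \<phi>s. Vector_Spaces.linear scale (*) \<phi>)
     then (\<phi>s ! length us) v * c \<phi>s us ws else 0)" for us ws v \<phi>s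
  proof -
    have "(\<Prod>i<Suc (length us + length ws). (\<phi>s ! i) ((us @ v # ws) ! i)) =
      (\<phi>s ! length us) ((us @ v # ws) ! length us) *
      (\<Prod>i\<in>{..<Suc (length us + length ws)} - {length us}. (\<phi>s ! i) ((us @ v # ws) ! i))"
      by (rule prod.remove) auto
    also have "\<dots> = (\<phi>s ! length us) v * c \<phi>s us ws"
      unfolding c_def
      by (intro arg_cong2[of _ _ _ _ "(*)"] prod.cong refl) (auto simp: nth[of _ _ v])
    finally show ?thesis
      by (simp add: pure_tensor_def del: prod.lessThan_Suc)
  qed
  have lin: "(\<phi>s ! length us) (x + y) = (\<phi>s ! length us) x + (\<phi>s ! length us) y"
      "(\<phi>s ! length us) (scale a x) = a * (\<phi>s ! length us) x"
    if "length \<phi>s = Suc (length us + length ws)" "\<forall>\<phi>\<in>set \<phi>s. Vector_Spaces.linear scale (*) \<phi>"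
    for us ws :: "'v list" and \<phi>s :: "('v \<Rightarrow> 'a) list" and x y a
  proof -
    have "Vector_Spaces.linear scale (*) (\<phi>s ! length us)"
      using that by auto
    then interpret l: Vector_Spaces.linear scale "(*)" "\<phi>s ! length us" .
    show "(\<phi>s ! length us) (x + y) = (\<phi>s ! length us) x + (\<phi>s ! length us) y"
      by (rule l.add)
    show "(\<phi>s ! length us) (scale a x) = a * (\<phi>s ! length us) x"
      by (rule l.scale)
  qed
  show ?thesis
    unfolding multilinear_def
  proof (intro allI impI)
    fix us ws :: "'v list"
    show "Vector_Spaces.linear scale tensor_scale (\<lambda>v. pure_tensor scale (us @ v # ws))"
    proof unfold_locales
      fix x y a
      show "pure_tensor scale (us @ (x + y) # ws) =
        pure_tensor scale (us @ x # ws) + pure_tensor scale (us @ y # ws)"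
        by (rule ext) (simp add: eq lin(1)[of _ us ws] distrib_right)
      show "pure_tensor scale (us @ scale a x # ws) =
        tensor_scale a (pure_tensor scale (us @ x # ws))"
        by (rule ext) (simp add: eq lin(2)[of _ us ws] tensor_scale_def mult.assoc)
    qed
  qed
qed

lemma multilinear_expand:
  fixes s :: "'a::field \<Rightarrow> 'v::ab_group_add \<Rightarrow> 'v" and t :: "'a \<Rightarrow> 'w::ab_group_add \<Rightarrow> 'w"
  assumes "finite_dimensional_vector_space s B" and "vector_space t"
    and "multilinear s t (length vs) f"
  shows "f vs = (\<Sum>bs\<in>{bs. set bs \<subseteq> B \<and> length bs = length vs}.
     t (\<Prod>i<length vs. module.representation s B (vs ! i) (bs ! i)) (f bs))"
  using assms(3)
proof (induction vs arbitrary: f)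
  case Nil
  interpret vector_space t by fact
  have "{bs :: 'v list. set bs \<subseteq> B \<and> length bs = 0} = {[]}" by auto
  then show ?case by simp
next
  case (Cons v vs)
  interpret V: finite_dimensional_vector_space s B by fact
  interpret W: vector_space t by fact
  let ?L = "\<lambda>l. {bs. set bs \<subseteq> B \<and> length bs = l}"
  let ?r = "V.representation B"
  have "Vector_Spaces.linear s t (\<lambda>x. f ([] @ x # vs))"
    using Cons.prems unfolding multilinear_def by (metis length_Cons list.size(3) add_0)
  then interpret h: Vector_Spaces.linear s t "\<lambda>x. f (x # vs)" by simp
  have mult: "multilinear s t (length vs) (\<lambda>ws. f (b # ws))" for b
    unfolding multilinear_def
  proof (intro allI impI)
    fix us ws :: "'v list" assume "Suc (length us + length ws) = length vs"
    then have "Suc (length (b # us) + length ws) = length (v # vs)" by simp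
    then have "Vector_Spaces.linear s t (\<lambda>x. f ((b # us) @ x # ws))"
      using Cons.prems unfolding multilinear_def by blast
    then show "Vector_Spaces.linear s t (\<lambda>x. f (b # us @ x # ws))" by simp
  qed
  have "v = (\<Sum>b\<in>B. s (?r v b) b)"
    by (rule V.sum_representation_eq[symmetric])
      (auto simp: V.independent_Basis V.span_Basis V.finite_Basis)
  then have "f (v # vs) = (\<Sum>b\<in>B. t (?r v b) (f (b # vs)))"
    using h.sum[of "\<lambda>b. s (?r v b) b" B] h.scale by simp
  also have "\<dots> = (\<Sum>b\<in>B. \<Sum>bs\<in>?L (length vs).
      t (?r v b) (t (\<Prod>i<length vs. ?r (vs ! i) (bs ! i)) (f (b # bs))))"
    by (intro sum.cong refl, subst Cons.IH[OF mult]) (simp add: W.scale_sum_right)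
  also have "\<dots> = (\<Sum>(b, bs)\<in>B \<times> ?L (length vs).
      t (\<Prod>i<length (v # vs). ?r ((v # vs) ! i) ((b # bs) ! i)) (f (b # bs)))"
    by (simp add: sum.cartesian_product prod.lessThan_Suc_shift del: prod.lessThan_Suc)
  also have "\<dots> = (\<Sum>bs\<in>?L (length (v # vs)).
      t (\<Prod>i<length (v # vs). ?r ((v # vs) ! i) (bs ! i)) (f bs))"
    by (rule sum.reindex_bij_witness[of _ "\<lambda>bs. (hd bs, tl bs)" "\<lambda>(b, bs). b # bs"])
      (auto simp: length_Suc_conv)
  finally show ?case .
qed

lemma tensor_power_universal:
  fixes scale :: "'a::field \<Rightarrow> 'v::ab_group_add \<Rightarrow> 'v" and t :: "'a \<Rightarrow> 'w::ab_group_add \<Rightarrow> 'w"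
  assumes "finite_dimensional_vector_space scale B" and "vector_space t"
    and f: "multilinear scale t n f"
  shows "\<exists>L. Vector_Spaces.linear tensor_scale t L \<and>
      (\<forall>vs. length vs = n \<longrightarrow> L (pure_tensor scale vs) = f vs) \<and>
      (\<forall>L'. Vector_Spaces.linear tensor_scale t L' \<and>
         (\<forall>vs. length vs = n \<longrightarrow> L' (pure_tensor scale vs) = f vs)
         \<longrightarrow> (\<forall>F\<in>tensor_power scale n. L' F = L F))"
proof -
  interpret V: finite_dimensional_vector_space scale B by fact
  interpret W: vector_space t by fact
  interpret T: vector_space "tensor_scale :: 'a \<Rightarrow> ('v, 'a) tensor \<Rightarrow> ('v, 'a) tensor"
    by (rule vector_space_tensor_scale)
  interpret TW: vector_space_pair "tensor_scale :: 'a \<Rightarrow> ('v, 'a) tensor \<Rightarrow> ('v, 'a) tensor" t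
    by unfold_locales
  define d where "d b v = V.representation B v b" for b v
  have d: "Vector_Spaces.linear scale (*) (d b)" for b
    by unfold_locales
      (auto simp: d_def V.representation_add V.representation_scale V.independent_Basis
        V.span_Basis algebra_simps)
  define L where "L F = (\<Sum>bs\<in>{bs. set bs \<subseteq> B \<and> length bs = n}. t (F (map d bs)) (f bs))"
    for F :: "('v, 'a) tensor"
  have L: "Vector_Spaces.linear tensor_scale t L"
    by unfold_locales
      (simp_all add: L_def tensor_scale_def W.scale_left_distrib sum.distrib W.scale_sum_right)
  have L_pure: "L (pure_tensor scale vs) = f vs" if "length vs = n" for vs
    using multilinear_expand[OF assms(1,2), of vs f] f that
    by (auto simp: L_def pure_tensor_def d d_def intro!: sum.cong prod.cong arg_cong2[of _ _ _ _ t])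
  have "L' F = L F"
    if L': "Vector_Spaces.linear tensor_scale t L'"
      and pure: "\<forall>vs. length vs = n \<longrightarrow> L' (pure_tensor scale vs) = f vs"
      and F: "F \<in> tensor_power scale n" for L' F
  proof (rule TW.linear_eq_on[OF L' L F[unfolded tensor_power_def]])
    fix b assume "b \<in> {pure_tensor scale vs | vs. length vs = n}"
    then show "L' b = L b" using pure L_pure by auto
  qed
  with L L_pure show ?thesis by blast
qed

lemma finite_partitions: "finite {\<mu>. partition_of n \<mu>}"
proof (rule finite_subset)
  show "{\<mu>. partition_of n \<mu>} \<subseteq> {\<mu>. set \<mu> \<subseteq> {..n} \<and> length \<mu> \<le> n}"
  proof (clarsimp simp: partition_of_def, intro conjI)
    fix \<mu> :: "nat list" assume "\<forall>p\<in>set \<mu>. 0 < p"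
    then show "length \<mu> \<le> sum_list \<mu>" by (induction \<mu>) auto
    show "set \<mu> \<subseteq> {..sum_list \<mu>}" by (auto intro: member_le_sum_list)
  qed
  show "finite {\<mu>. set \<mu> \<subseteq> {..n} \<and> length \<mu> \<le> n}"
    by (rule finite_lists_length_le) simp
qed

lemma finite_young_diagram: "finite (young_diagram \<mu>)"
proof -
  have "young_diagram \<mu> = (SIGMA i:{..<length \<mu>}. {..<\<mu> ! i})"
    by (auto simp: young_diagram_def row_length_def split: if_splits)
  then show ?thesis by simp
qed

lemma finite_SYT: "finite (SYT \<mu>)"
proof (rule finite_subset)
  show "SYT \<mu> \<subseteq> young_diagram \<mu> \<rightarrow>\<^sub>E {1..sum_list \<mu>}"
    by (auto simp: SYT_def PiE_def bij_betw_def)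
  show "finite (young_diagram \<mu> \<rightarrow>\<^sub>E {1..sum_list \<mu>})"
    by (intro finite_PiE finite_young_diagram) simp
qed

end

theory Submission
  imports Defs "HOL-Library.List_Lexorder"
begin

text \<open>
  Choose an orthonormal basis \<open>e\<^sub>0, \<dots>, e\<^sub>k\<^sub>-\<^sub>1\<close> of \<open>V\<close>. A tensor in \<open>V\<^sup>\<otimes>\<^sup>n\<close> has one coordinate for each word
  of length \<open>n\<close> in the letters \<open>0, \<dots>, k - 1\<close>; order the words lexicographically. Call a word good if it
  is a lattice word and its letters occur all an even or all an odd number of times. The
  dimension formula holds because the good words are exactly the least words of nonzero invariant
  tensors, that is, the lexicographically first words with nonzero coordinate. A space of vectors
  with finitely many coordinates has as many least words as its dimension, and good words
  correspond to standard tableaux of the shapes in question (\<open>card_good_words\<close>): a tableau is encoded by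
  the word of the rows of its entries.

  Least words are good (\<open>least_word_good\<close>): it suffices to use rotations in the planes of two
  consecutive basis vectors. Half turns give the parity condition. For the lattice condition consider a
  rotation that multiplies two isotropic functionals by \<open>4\<close> and \<open>1/4\<close>. An invariant tensor has only
  coordinates of weight zero with respect to these, and a range of possible weights can be followed while the
  slots are fixed one by one to the letters of the least word. A letter \<open>j\<close> widens this range, a
  letter \<open>j + 1\<close> narrows it by the same amount, and the tensor would vanish at the word if the
  range became empty (\<open>excess_bound\<close>).

  Good words are least words (\<open>word_tensor\<close>): pair consecutive columns of the tableau, setting aside the
  first one if all rows are odd. For each pair take the determinant of the matrix of
  contractions between the two columns, and for a column set aside the \<open>k \<times> k\<close> determinant of its slots.
  The product is an invariant whose nonzero coordinates belong to words without repeated letters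
  in a column of the tableau. The least such word is the given one, and its coordinate is \<open>1\<close>.
\<close>

section \<open>Lattice words\<close>

text \<open>Also called Yamanouchi or ballot words.\<close>

definition lattice_word :: "nat list \<Rightarrow> bool" where
  "lattice_word w \<longleftrightarrow> (\<forall>r i. count_list (take r w) (Suc i) \<le> count_list (take r w) i)"

definition same_parity_word :: "nat \<Rightarrow> nat list \<Rightarrow> bool" where
  "same_parity_word k w \<longleftrightarrow> (\<forall>i<k. even (count_list w i)) \<or> (\<forall>i<k. odd (count_list w i))"

definition words :: "nat \<Rightarrow> nat \<Rightarrow> nat list set" where
  "words k n = {w. set w \<subseteq> {..<k} \<and> length w = n}"

definition good_words :: "nat \<Rightarrow> nat \<Rightarrow> nat list set" where
  "good_words k n = {w \<in> words k n. lattice_word w \<and> same_parity_word k w}"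

text \<open>Listing the positions of a lattice word letter by letter fills a Young diagram: position \<open>p\<close> goes
  to row \<open>w ! p\<close>, and \<open>column w p\<close> is the first free place in that row.\<close>

definition column :: "nat list \<Rightarrow> nat \<Rightarrow> nat" where
  "column w p = count_list (take p w) (w ! p)"

definition cell_position :: "nat list \<Rightarrow> nat \<Rightarrow> nat \<Rightarrow> nat" where
  "cell_position w i c = (THE p. p < length w \<and> w ! p = i \<and> column w p = c)"

lemma finite_words: "finite (words k n)"
  unfolding words_def by (rule finite_lists_length_eq) simp

lemma finite_good_words: "finite (good_words k n)"
  unfolding good_words_def using finite_words by simp

lemma wordsD:
  assumes "w \<in> words k n"
  shows "length w = n" and "p < n \<Longrightarrow> w ! p < k"
  using assms by (auto simp: words_def subset_iff)

lemma count_list_take_Suc: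
  "p < length w \<Longrightarrow> count_list (take (Suc p) w) i = count_list (take p w) i + (if w ! p = i then 1 else 0)"
  by (simp add: take_Suc_conv_app_nth)

lemma count_list_take_mono: "r \<le> s \<Longrightarrow> count_list (take r w) i \<le> count_list (take s w) i"
proof -
  assume "r \<le> s"
  then have "take s w = take r w @ take (s - r) (drop r w)"
    by (metis le_add_diff_inverse take_add)
  then show ?thesis by simp
qed

lemma column_less_count:
  assumes "p < r" "r \<le> length w"
  shows "column w p < count_list (take r w) (w ! p)"
proof -
  have "column w p < count_list (take (Suc p) w) (w ! p)"
    using assms by (simp add: count_list_take_Suc column_def)
  also have "\<dots> \<le> count_list (take r w) (w ! p)"
    using assms by (intro count_list_take_mono) simp
  finally show ?thesis .
qed

lemma column_strict_mono:
  assumes "p < q" "q < length w" "w ! p = w ! q"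
  shows "column w p < column w q"
  using column_less_count[of p q w] assms by (simp add: column_def)

lemma cell_inj:
  assumes "p < length w" "q < length w" "w ! p = w ! q" "column w p = column w q"
  shows "p = q"
  using column_strict_mono[of p q w] column_strict_mono[of q p w] assms
  by (cases p q rule: linorder_cases) auto

lemma ex_cell:
  assumes "c < count_list (take r w) i" "r \<le> length w"
  shows "\<exists>p<r. w ! p = i \<and> column w p = c"
  using assms
proof (induction r)
  case (Suc r)
  show ?case
  proof (cases "c < count_list (take r w) i")
    case True
    with Suc obtain p where "p < r" "w ! p = i" "column w p = c" by auto
    then show ?thesis by (intro exI[of _ p]) auto
  next
    case False
    with Suc.prems have "w ! r = i" "c = count_list (take r w) i"
      by (auto simp: count_list_take_Suc split: if_splits)
    then show ?thesis by (intro exI[of _ r]) (auto simp: column_def)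
  qed
qed simp

lemma cell_position_cell:
  assumes "p < length w"
  shows "cell_position w (w ! p) (column w p) = p"
  unfolding cell_position_def using assms by (intro the_equality) (auto intro: cell_inj)

lemma cell_position:
  assumes "c < count_list w i"
  shows "cell_position w i c < length w" "w ! cell_position w i c = i"
    "column w (cell_position w i c) = c"
proof -
  obtain p where "p < length w" "w ! p = i" "column w p = c"
    using ex_cell[of c "length w" w i] assms by auto
  with cell_position_cell[of p w]
  show "cell_position w i c < length w" "w ! cell_position w i c = i"
    "column w (cell_position w i c) = c" by auto
qed

text \<open>When a letter is appended to a lattice word, every smaller letter must already have occurred more
  often than it; hence all cells above the new one are filled.\<close>

lemma lattice_cell_above:
  assumes w: "lattice_word w" and p: "p < length w" and i: "i < w ! p"
  shows "\<exists>q<p. w ! q = i \<and> column w q = column w p"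
proof -
  have anti: "count_list (take r w) (j + d) \<le> count_list (take r w) j" for r j d
  proof (induction d)
    case (Suc d)
    have "count_list (take r w) (Suc (j + d)) \<le> count_list (take r w) (j + d)"
      using w by (simp add: lattice_word_def)
    with Suc show ?case by simp
  qed simp
  obtain d where d: "w ! p = Suc i + d" using i less_imp_Suc_add by (metis add_Suc)
  have "column w p < count_list (take (Suc p) w) (w ! p)"
    using p by (intro column_less_count) auto
  also have "\<dots> \<le> count_list (take (Suc p) w) i"
    using anti[of "Suc p" i "Suc d"] d by simp
  also have "\<dots> = count_list (take p w) i" using p i by (simp add: count_list_take_Suc)
  finally have "\<exists>q<p. w ! q = i \<and> column w q = column w p"
    using p by (intro ex_cell) auto
  then show ?thesis .
qed

lemma list_less_same_length:
  fixes u w :: "nat list"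
  assumes "length u = length w"
  shows "u < w \<longleftrightarrow> (\<exists>p<length w. take p u = take p w \<and> u ! p < w ! p)"
  using assms by (auto simp: list_less_def lexord_take_index_conv)

text \<open>At the first position where \<open>u\<close> is smaller than \<open>w\<close>, the cells above it in its column are already
  filled, and \<open>w\<close> puts every smaller letter there. Since \<open>u\<close> agrees with \<open>w\<close> so far, it would have to
  repeat a letter in that column. This is what makes \<open>w\<close> the leading word of a tensor that is
  alternating in each column of \<open>w\<close>.\<close>

lemma lattice_word_least_injective:
  assumes w: "lattice_word w" and len: "length u = length w"
    and inj: "\<And>p q. p < length w \<Longrightarrow> q < length w \<Longrightarrow> column w p = column w q \<Longrightarrow> u ! p = u ! q \<Longrightarrow> p = q"
  shows "w \<le> u"
proof (rule ccontr)
  assume "\<not> w \<le> u"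
  then have "u < w" by simp
  then obtain p where p: "p < length w" "take p u = take p w" "u ! p < w ! p"
    using list_less_same_length[OF len] by auto
  obtain q where q: "q < p" "w ! q = u ! p" "column w q = column w p"
    using lattice_cell_above[OF w p(1,3)] by auto
  have "u ! q = w ! q" using p(2) q(1) by (metis nth_take)
  with q p inj[of p q] show False by auto
qed

section \<open>Lattice words and standard tableaux\<close>

text \<open>Letters that do not occur must not contribute a part, since parts of a partition are positive.\<close>

definition row_lengths :: "nat \<Rightarrow> nat list \<Rightarrow> nat list" where
  "row_lengths k w = filter (\<lambda>m. 0 < m) (map (count_list w) [0..<k])"

text \<open>The word recording, for each entry of a tableau in turn, the row that contains it.\<close>

definition row_word :: "nat \<Rightarrow> (nat \<times> nat \<Rightarrow> nat) \<Rightarrow> nat list \<Rightarrow> nat list" where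
  "row_word n T \<mu> = map (\<lambda>p. fst (inv_into (young_diagram \<mu>) T (Suc p))) [0..<n]"

text \<open>For a decreasing function, deleting the zeros from the list of values just cuts off a tail, so the
  remaining entries keep their indices.\<close>

lemma filter_pos_antimono:
  assumes "\<And>i j. i \<le> j \<Longrightarrow> f j \<le> (f i :: nat)"
  shows "\<exists>l\<le>k. filter (\<lambda>m. 0 < m) (map f [0..<k]) = map f [0..<l] \<and> (\<forall>i<k. l \<le> i \<longrightarrow> f i = 0)"
proof (induction k)
  case (Suc k)
  then obtain l where l: "l \<le> k" "filter (\<lambda>m. 0 < m) (map f [0..<k]) = map f [0..<l]"
      "\<forall>i<k. l \<le> i \<longrightarrow> f i = 0" by auto
  show ?case
  proof (cases "f k = 0")
    case True
    with l show ?thesis by (intro exI[of _ l]) (auto simp: less_Suc_eq)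
  next
    case False
    have "l = k"
    proof (rule ccontr)
      assume "l \<noteq> k"
      with l have "f l = 0" by auto
      with assms[of l k] l False show False by auto
    qed
    with False l show ?thesis by (intro exI[of _ "Suc k"]) auto
  qed
qed simp

lemma lattice_count_antimono:
  assumes "lattice_word w" "i \<le> j"
  shows "count_list w j \<le> count_list w i"
  using assms(2)
proof (induction j rule: dec_induct)
  case (step m)
  have "count_list (take (length w) w) (Suc m) \<le> count_list (take (length w) w) m"
    using assms(1) unfolding lattice_word_def by blast
  with step show ?case by simp
qed simp

lemma row_length_row_lengths:
  assumes w: "lattice_word w" "w \<in> words k n"
  shows "row_length (row_lengths k w) i = count_list w i"
    and "length (row_lengths k w) \<le> k"
    and "partition_of n (row_lengths k w)"
proof -
  obtain l where l: "l \<le> k" "row_lengths k w = map (count_list w) [0..<l]"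
    "\<forall>i<k. l \<le> i \<longrightarrow> count_list w i = 0"
    using filter_pos_antimono[where f = "count_list w" and k = k, OF lattice_count_antimono[OF w(1)]]
    by (auto simp: row_lengths_def)
  have 0: "count_list w i = 0" if "l \<le> i" for i
    using that l(3) w(2) by (cases "i < k") (auto simp: words_def intro!: count_notin)
  then show "row_length (row_lengths k w) i = count_list w i"
    using l(2) by (auto simp: row_length_def)
  show "length (row_lengths k w) \<le> k" using l by simp
  have "sum_list (map (count_list w) [0..<l]) = (\<Sum>i<l. count_list w i)"
    by (simp add: sum_list_distinct_conv_sum_set atLeast0LessThan)
  also have "\<dots> = (\<Sum>i\<in>set w. count_list w i)"
  proof (rule sum.mono_neutral_right)
    show "set w \<subseteq> {..<l}"
    proof
      fix i assume "i \<in> set w"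
      then have "count_list w i \<noteq> 0" by (simp add: count_list_0_iff)
      with 0[of i] show "i \<in> {..<l}" by force
    qed
  qed (auto simp: count_list_0_iff)
  also have "\<dots> = n" using w(2) sum_count_set[of w "set w"] by (simp add: words_def)
  finally have "sum_list (row_lengths k w) = n" using l by simp
  moreover have "sorted_wrt (\<ge>) (row_lengths k w)"
    using l(2) lattice_count_antimono[OF w(1)] by (auto simp: sorted_wrt_iff_nth_less)
  moreover have "\<forall>p\<in>set (row_lengths k w). 0 < p" by (auto simp: row_lengths_def)
  ultimately show "partition_of n (row_lengths k w)" by (simp add: partition_of_def)
qed

lemma partition_eqI:
  assumes "partition_of n \<mu>" "partition_of n' \<nu>" "\<And>i. row_length \<mu> i = row_length \<nu> i"
  shows "\<mu> = \<nu>"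
proof -
  have pos: "row_length \<mu> i = 0 \<longleftrightarrow> length \<mu> \<le> i" if "partition_of n \<mu>" for i \<mu> n
    using that nth_mem[of i \<mu>] by (force simp: partition_of_def row_length_def)
  have "length \<mu> = length \<nu>"
    using pos[OF assms(1)] pos[OF assms(2)] assms(3) by (metis le_refl nle_le)
  then show ?thesis using assms(3)
    by (intro nth_equalityI) (auto simp: row_length_def split: if_splits, metis)
qed

definition word_tableau :: "nat list \<Rightarrow> nat \<times> nat \<Rightarrow> nat" where
  "word_tableau w = (\<lambda>(i, j). if j < count_list w i then Suc (cell_position w i j) else undefined)"

lemma word_tableau_cell:
  assumes "p < length w"
  shows "word_tableau w (w ! p, column w p) = Suc p"
  using assms column_less_count[of p "length w" w]
  by (simp add: word_tableau_def cell_position_cell)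

lemma mem_young_diagram: "(i, j) \<in> young_diagram \<mu> \<longleftrightarrow> j < row_length \<mu> i"
  by (simp add: young_diagram_def)

lemma count_list_take_card:
  assumes "r \<le> length w"
  shows "count_list (take r w) i = card {q. q < r \<and> w ! q = i}"
  using assms
proof (induction r)
  case (Suc r)
  have "{q. q < Suc r \<and> w ! q = i} = {q. q < r \<and> w ! q = i} \<union> (if w ! r = i then {r} else {})"
    by (auto simp: less_Suc_eq)
  with Suc show ?case by (simp add: count_list_take_Suc)
qed simp

lemma SYTD:
  assumes "T \<in> SYT \<mu>"
  shows "T \<in> extensional (young_diagram \<mu>)"
    and "bij_betw T (young_diagram \<mu>) {1..sum_list \<mu>}"
    and "j < j' \<Longrightarrow> j' < row_length \<mu> i \<Longrightarrow> T (i, j) < T (i, j')"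
    and "i < i' \<Longrightarrow> j < row_length \<mu> i \<Longrightarrow> j < row_length \<mu> i' \<Longrightarrow> T (i, j) < T (i', j)"
  using assms unfolding SYT_def by (auto simp: mem_young_diagram)

text \<open>In row \<open>i\<close> of a standard tableau the entries up to \<open>r\<close> fill an initial segment, whose length is the
  number of letters \<open>i\<close> among the first \<open>r\<close> letters of the row word (\<open>count_row_word\<close>). So the
  increase along rows says that the column of an entry is read off the word, and the increase along
  columns is the lattice condition.\<close>

context
  fixes \<mu> n T w
  assumes \<mu>: "partition_of n \<mu>" and T: "T \<in> SYT \<mu>" and w_def: "w = row_word n T \<mu>"
begin

lemma tableau_bij: "bij_betw T (young_diagram \<mu>) {1..n}"
  using SYTD(2)[OF T] \<mu> by (simp add: partition_of_def)

lemma tableau_inj: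
  "j < row_length \<mu> i \<Longrightarrow> j' < row_length \<mu> i' \<Longrightarrow> T (i, j) = T (i', j') \<Longrightarrow> (i, j) = (i', j')"
  by (rule inj_onD[OF bij_betw_imp_inj_on[OF tableau_bij]]) (auto simp: mem_young_diagram)

lemma tableau_range:
  "j < row_length \<mu> i \<Longrightarrow> 1 \<le> T (i, j) \<and> T (i, j) \<le> n"
  using bij_betw_apply[OF tableau_bij, of "(i, j)"] by (auto simp: mem_young_diagram)

lemma tableau_surj:
  assumes "p < n"
  shows "\<exists>i j. j < row_length \<mu> i \<and> T (i, j) = Suc p"
proof -
  have "Suc p \<in> T ` young_diagram \<mu>"
    using assms bij_betw_imp_surj_on[OF tableau_bij] by simp
  then show ?thesis by (force simp: mem_young_diagram)
qed

lemma length_row_word: "length w = n"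
  by (simp add: w_def row_word_def)

lemma nth_row_word:
  assumes "j < row_length \<mu> i" "T (i, j) = Suc p"
  shows "w ! p = i"
proof -
  have "p < n" using tableau_range[OF assms(1)] assms(2) by simp
  moreover have "inv_into (young_diagram \<mu>) T (Suc p) = (i, j)"
    using assms bij_betw_imp_inj_on[OF tableau_bij]
    by (intro inv_into_f_eq) (auto simp: mem_young_diagram)
  ultimately show ?thesis by (simp add: w_def row_word_def)
qed

lemma count_row_word:
  assumes "r \<le> n"
  shows "count_list (take r w) i = card {j. j < row_length \<mu> i \<and> T (i, j) \<le> r}"
proof -
  have "count_list (take r w) i = card {q. q < r \<and> w ! q = i}"
    using assms by (intro count_list_take_card) (simp add: length_row_word)
  also have "\<dots> = card {j. j < row_length \<mu> i \<and> T (i, j) \<le> r}"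
  proof (rule bij_betw_same_card[symmetric], rule bij_betwI')
    fix j j' assume "j \<in> {j. j < row_length \<mu> i \<and> T (i, j) \<le> r}" "j' \<in> {j. j < row_length \<mu> i \<and> T (i, j) \<le> r}"
    then show "(T (i, j) - 1 = T (i, j') - 1) = (j = j')"
      using tableau_inj[of j i j' i] tableau_range[of j i] tableau_range[of j' i] by fastforce
  next
    fix j assume "j \<in> {j. j < row_length \<mu> i \<and> T (i, j) \<le> r}"
    then show "T (i, j) - 1 \<in> {q. q < r \<and> w ! q = i}"
      using tableau_range[of j i] nth_row_word[of j i "T (i, j) - 1"] by auto
  next
    fix q assume q: "q \<in> {q. q < r \<and> w ! q = i}"
    then obtain i' j where "j < row_length \<mu> i'" "T (i', j) = Suc q"
      using tableau_surj[of q] assms by auto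
    with nth_row_word[OF this] q
    show "\<exists>j\<in>{j. j < row_length \<mu> i \<and> T (i, j) \<le> r}. q = T (i, j) - 1"
      by (intro bexI[of _ j]) auto
  qed
  finally show ?thesis .
qed

lemma count_row_word_all: "count_list w i = row_length \<mu> i"
proof -
  have "{j. j < row_length \<mu> i \<and> T (i, j) \<le> n} = {..<row_length \<mu> i}"
    using tableau_range by auto
  then show ?thesis using count_row_word[of n i] by (simp add: length_row_word)
qed

lemma column_row_word:
  assumes "j < row_length \<mu> i" "T (i, j) = Suc p"
  shows "column w p = j"
proof -
  have "{j'. j' < row_length \<mu> i \<and> T (i, j') \<le> p} = {..<j}"
  proof (intro equalityI subsetI; simp)
    fix j' assume j': "j' < row_length \<mu> i \<and> T (i, j') \<le> p"
    then show "j' < j" using SYTD(3)[OF T, of j j' i] assms by (cases j j' rule: linorder_cases) auto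
  next
    fix j' assume "j' < j"
    then show "j' < row_length \<mu> i \<and> T (i, j') \<le> p"
      using SYTD(3)[OF T, of j' j i] assms by auto
  qed
  moreover have "p < n" using tableau_range[OF assms(1)] assms(2) by simp
  ultimately show ?thesis
    using count_row_word[of p i] nth_row_word[OF assms] by (simp add: column_def)
qed

lemma row_length_antimono: "i \<le> i' \<Longrightarrow> row_length \<mu> i' \<le> row_length \<mu> i"
  using \<mu> by (cases "i = i'") (auto simp: row_length_def partition_of_def sorted_wrt_iff_nth_less)

lemma lattice_row_word: "lattice_word w"
  unfolding lattice_word_def
proof (intro allI)
  fix r i
  define s where "s = min r n"
  have "{j. j < row_length \<mu> (Suc i) \<and> T (Suc i, j) \<le> s} \<subseteq> {j. j < row_length \<mu> i \<and> T (i, j) \<le> s}"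
  proof clarify
    fix j assume j: "j < row_length \<mu> (Suc i)" "T (Suc i, j) \<le> s"
    with row_length_antimono[of i "Suc i"] have "j < row_length \<mu> i" by simp
    with SYTD(4)[OF T, of i "Suc i" j] j show "j < row_length \<mu> i \<and> T (i, j) \<le> s" by simp
  qed
  then have "count_list (take s w) (Suc i) \<le> count_list (take s w) i"
    by (simp add: count_row_word s_def card_mono)
  moreover have "take s w = take r w" by (simp add: s_def length_row_word min_def)
  ultimately show "count_list (take r w) (Suc i) \<le> count_list (take r w) i" by simp
qed

lemma row_word_good:
  assumes "length \<mu> \<le> k" "rows_same_parity k \<mu>"
  shows "w \<in> good_words k n"
proof -
  have "w ! p < k" if p: "p < n" for p
  proof -
    obtain i j where ij: "j < row_length \<mu> i" "T (i, j) = Suc p"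
      using tableau_surj[OF p] by auto
    then have "i < length \<mu>" by (simp add: row_length_def split: if_splits)
    with nth_row_word[OF ij] assms show ?thesis by simp
  qed
  then have "w \<in> words k n" by (auto simp: words_def length_row_word in_set_conv_nth)
  with lattice_row_word assms(2) show ?thesis
    by (simp add: good_words_def same_parity_word_def rows_same_parity_def count_row_word_all)
qed

lemma word_tableau_row_word: "word_tableau w = T"
proof
  fix x :: "nat \<times> nat"
  obtain i j where x: "x = (i, j)" by fastforce
  show "word_tableau w x = T x"
  proof (cases "j < row_length \<mu> i")
    case True
    define p where "p = T (i, j) - 1"
    have p: "T (i, j) = Suc p" using tableau_range[OF True] by (simp add: p_def)
    then have "p < length w" using tableau_range[OF True] by (simp add: length_row_word)
    from word_tableau_cell[OF this] show ?thesis
      using nth_row_word[OF True p] column_row_word[OF True p] p x by simp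
  next
    case False
    with SYTD(1)[OF T] show ?thesis
      by (simp add: x word_tableau_def count_row_word_all extensional_def mem_young_diagram)
  qed
qed

lemma row_lengths_row_word:
  assumes "length \<mu> \<le> k" "rows_same_parity k \<mu>"
  shows "row_lengths k w = \<mu>"
proof -
  have w: "lattice_word w" "w \<in> words k n"
    using row_word_good[OF assms] by (simp_all add: good_words_def)
  show ?thesis
    by (rule partition_eqI[OF row_length_row_lengths(3)[OF w] \<mu>])
      (simp add: row_length_row_lengths(1)[OF w] count_row_word_all)
qed

end

text \<open>Rows increase because columns are numbered in order of occurrence; columns increase because of
  \<open>lattice_cell_above\<close>.\<close>

lemma word_tableau_SYT:
  assumes w: "lattice_word w" "w \<in> words k n"
  shows "word_tableau w \<in> SYT (row_lengths k w)"
    and "row_word n (word_tableau w) (row_lengths k w) = w"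
proof -
  let ?D = "young_diagram (row_lengths k w)" and ?T = "word_tableau w"
  have len: "length w = n" using w by (simp add: words_def)
  have D: "(i, j) \<in> ?D \<longleftrightarrow> j < count_list w i" for i j
    by (simp add: mem_young_diagram row_length_row_lengths(1)[OF w])
  have cell: "\<exists>p<n. w ! p = i \<and> column w p = j \<and> ?T (i, j) = Suc p"
    if "(i, j) \<in> ?D" for i j
    using ex_cell[of j n w i] that word_tableau_cell[of _ w] by (auto simp: D len)
  have cell': "(w ! p, column w p) \<in> ?D" "?T (w ! p, column w p) = Suc p" if "p < n" for p
    using that column_less_count[of p n w] word_tableau_cell[of p w] by (auto simp: D len)
  have inj: "inj_on ?T ?D"
  proof (rule inj_onI)
    fix x y assume xy: "x \<in> ?D" "y \<in> ?D" "?T x = ?T y"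
    then show "x = y"
      using cell[of "fst x" "snd x"] cell[of "fst y" "snd y"] by (cases x; cases y) auto
  qed
  have "?T ` ?D = {1..n}"
  proof (intro equalityI subsetI)
    fix y assume "y \<in> ?T ` ?D"
    then show "y \<in> {1..n}" using cell by fastforce
  next
    fix y assume "y \<in> {1..n}"
    then have "y - 1 < n" "y = Suc (y - 1)" by auto
    with cell'[of "y - 1"] show "y \<in> ?T ` ?D" by (metis imageI)
  qed
  with inj have bij: "bij_betw ?T ?D {1..n}" by (simp add: bij_betw_def)
  have row: "?T (i, j) < ?T (i, j')"
    if ij: "(i, j) \<in> ?D" "(i, j') \<in> ?D" and less: "j < j'" for i j j'
  proof -
    obtain p where p: "p < n" "w ! p = i" "column w p = j" "?T (i, j) = Suc p"
      using cell[OF ij(1)] by auto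
    obtain q where q: "q < n" "w ! q = i" "column w q = j'" "?T (i, j') = Suc q"
      using cell[OF ij(2)] by auto
    show ?thesis using column_strict_mono[of q p w] p q less len
      by (cases p q rule: linorder_cases) auto
  qed
  have col: "?T (i, j) < ?T (i', j)"
    if ij: "(i, j) \<in> ?D" "(i', j) \<in> ?D" and less: "i < i'" for i i' j
  proof -
    obtain p where p: "p < n" "w ! p = i'" "column w p = j" "?T (i', j) = Suc p"
      using cell[OF ij(2)] by auto
    obtain q where "q < p" "w ! q = i" "column w q = j"
      using lattice_cell_above[OF w(1), of p i] p less len by auto
    with p word_tableau_cell[of q w] len show ?thesis by auto
  qed
  have ext: "?T \<in> extensional ?D"
    by (auto simp: extensional_def word_tableau_def D)
  have sum: "sum_list (row_lengths k w) = n"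
    using row_length_row_lengths(3)[OF w] by (simp add: partition_of_def)
  show "?T \<in> SYT (row_lengths k w)"
    unfolding SYT_def using ext bij row col sum by auto
  show "row_word n ?T (row_lengths k w) = w"
  proof (rule nth_equalityI)
    fix p assume "p < length (row_word n ?T (row_lengths k w))"
    then have p: "p < n" by (simp add: row_word_def)
    with cell'[OF p] inj have "inv_into ?D ?T (Suc p) = (w ! p, column w p)"
      by (intro inv_into_f_eq) auto
    then show "row_word n ?T (row_lengths k w) ! p = w ! p" using p by (simp add: row_word_def)
  qed (simp add: row_word_def len)
qed

lemma card_good_words:
  "card (good_words k n) = (\<Sum>\<mu> | partition_of n \<mu> \<and> length \<mu> \<le> k \<and> rows_same_parity k \<mu>. card (SYT \<mu>))"
proof -
  let ?P = "{\<mu>. partition_of n \<mu> \<and> length \<mu> \<le> k \<and> rows_same_parity k \<mu>}"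
  have fin: "finite ?P" by (rule finite_subset[OF _ finite_partitions[of n]]) auto
  have "bij_betw (\<lambda>(\<mu>, T). row_word n T \<mu>) (SIGMA \<mu>:?P. SYT \<mu>) (good_words k n)"
  proof (rule bij_betw_byWitness[where f' = "\<lambda>w. (row_lengths k w, word_tableau w)"])
    show "\<forall>x\<in>SIGMA \<mu>:?P. SYT \<mu>. (\<lambda>w. (row_lengths k w, word_tableau w)) ((\<lambda>(\<mu>, T). row_word n T \<mu>) x) = x"
      by (auto simp: word_tableau_row_word row_lengths_row_word)
    show "\<forall>w\<in>good_words k n. (\<lambda>(\<mu>, T). row_word n T \<mu>) (row_lengths k w, word_tableau w) = w"
      by (auto simp: good_words_def word_tableau_SYT(2))
    show "(\<lambda>(\<mu>, T). row_word n T \<mu>) ` (SIGMA \<mu>:?P. SYT \<mu>) \<subseteq> good_words k n"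
      by (auto intro: row_word_good)
    show "(\<lambda>w. (row_lengths k w, word_tableau w)) ` good_words k n \<subseteq> (SIGMA \<mu>:?P. SYT \<mu>)"
      by (auto simp: good_words_def word_tableau_SYT(1) row_length_row_lengths
          rows_same_parity_def same_parity_word_def)
  qed
  then have "card (good_words k n) = card (SIGMA \<mu>:?P. SYT \<mu>)"
    by (simp add: bij_betw_same_card)
  also have "\<dots> = (\<Sum>\<mu>\<in>?P. card (SYT \<mu>))"
    using fin finite_SYT by (intro card_SigmaI) auto
  finally show ?thesis .
qed

section \<open>Orthonormal bases\<close>

lemma sum_split_plane:
  fixes f :: "nat \<Rightarrow> 'a::comm_monoid_add"
  assumes "Suc j < k"
  shows "(\<Sum>i<k. f i) = f j + f (Suc j) + sum f ({..<k} - {j, Suc j})"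
proof -
  have "(\<Sum>i<k. f i) = sum f {j, Suc j} + sum f ({..<k} - {j, Suc j})"
    using assms by (subst add.commute, intro sum.subset_diff) auto
  then show ?thesis by simp
qed

text \<open>By the expansion, \<open>e\<close> spans, and a vector orthogonal to everything is zero.\<close>

locale orthonormal_basis = vector_space scale
  for scale :: "complex \<Rightarrow> 'v::ab_group_add \<Rightarrow> 'v" +
  fixes \<beta> :: "'v \<Rightarrow> 'v \<Rightarrow> complex" and e :: "nat \<Rightarrow> 'v" and k :: nat
  assumes bilinear: "bilinear_form scale \<beta>" and symmetric: "symmetric_form \<beta>"
    and orthonormal: "i < k \<Longrightarrow> j < k \<Longrightarrow> \<beta> (e i) (e j) = (if i = j then 1 else 0)"
    and expansion: "x = (\<Sum>i<k. scale (\<beta> x (e i)) (e i))"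

lemma bilinear_form_linear:
  assumes "bilinear_form scale \<beta>"
  shows "Vector_Spaces.linear scale (*) (\<beta> x)" "Vector_Spaces.linear scale (*) (\<lambda>x. \<beta> x y)"
  using assms by (auto simp: bilinear_form_def)

lemma bilinear_form_simps:
  assumes "bilinear_form scale \<beta>"
  shows "\<beta> x (y + z) = \<beta> x y + \<beta> x z" "\<beta> (x + y) z = \<beta> x z + \<beta> y z"
    "\<beta> x (scale c y) = c * \<beta> x y" "\<beta> (scale c x) y = c * \<beta> x y"
    "\<beta> x (y - z) = \<beta> x y - \<beta> x z" "\<beta> (x - y) z = \<beta> x z - \<beta> y z"
    "\<beta> x (sum f A) = (\<Sum>a\<in>A. \<beta> x (f a))" "\<beta> (sum f A) y = (\<Sum>a\<in>A. \<beta> (f a) y)"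
    "\<beta> x 0 = 0" "\<beta> 0 y = 0"
proof -
  interpret l: Vector_Spaces.linear scale "(*)" "\<beta> x" for x
    by (rule bilinear_form_linear[OF assms])
  interpret r: Vector_Spaces.linear scale "(*)" "\<lambda>x. \<beta> x y" for y
    by (rule bilinear_form_linear[OF assms])
  show "\<beta> x (y + z) = \<beta> x y + \<beta> x z" "\<beta> (x + y) z = \<beta> x z + \<beta> y z"
    "\<beta> x (scale c y) = c * \<beta> x y" "\<beta> (scale c x) y = c * \<beta> x y"
    "\<beta> x (y - z) = \<beta> x y - \<beta> x z" "\<beta> (x - y) z = \<beta> x z - \<beta> y z"
    "\<beta> x (sum f A) = (\<Sum>a\<in>A. \<beta> x (f a))" "\<beta> (sum f A) y = (\<Sum>a\<in>A. \<beta> (f a) y)"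
    "\<beta> x 0 = 0" "\<beta> 0 y = 0"
    using l.add r.add l.scale r.scale l.diff r.diff l.sum r.sum l.zero r.zero by auto
qed

definition orthonormal_family :: "('v \<Rightarrow> 'v \<Rightarrow> complex) \<Rightarrow> nat \<Rightarrow> (nat \<Rightarrow> 'v) \<Rightarrow> bool" where
  "orthonormal_family \<beta> m e \<longleftrightarrow> (\<forall>i<m. \<forall>j<m. \<beta> (e i) (e j) = (if i = j then 1 else 0))"

lemma orthonormal_family_independent:
  fixes scale :: "complex \<Rightarrow> 'v::ab_group_add \<Rightarrow> 'v"
  assumes "vector_space scale" and \<beta>: "bilinear_form scale \<beta>" and e: "orthonormal_family \<beta> m e"
  shows "inj_on e {..<m}" and "\<not> module.dependent scale (e ` {..<m})"
proof -
  interpret vector_space scale by fact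
  show inj: "inj_on e {..<m}"
  proof (rule inj_onI)
    fix i j assume ij: "i \<in> {..<m}" "j \<in> {..<m}" "e i = e j"
    have "\<beta> (e i) (e i) = 1" "\<beta> (e i) (e j) = (if i = j then 1 else 0)"
      using e ij(1,2) unfolding orthonormal_family_def by (metis lessThan_iff)+
    with ij(3) show "i = j" by (auto split: if_splits)
  qed
  show "\<not> dependent (e ` {..<m})"
  proof
    assume "dependent (e ` {..<m})"
    then obtain u v where uv: "v \<in> e ` {..<m}" "u v \<noteq> 0" "(\<Sum>v\<in>e ` {..<m}. scale (u v) v) = 0"
      by (auto simp: dependent_finite)
    then obtain j where j: "j < m" "v = e j" by auto
    have "0 = \<beta> (\<Sum>v\<in>e ` {..<m}. scale (u v) v) (e j)"
      using uv(3) by (simp add: bilinear_form_simps[OF \<beta>])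
    also have "\<dots> = (\<Sum>i<m. u (e i) * \<beta> (e i) (e j))"
      using inj by (simp add: sum.reindex bilinear_form_simps[OF \<beta>])
    also have "\<dots> = (\<Sum>i<m. if i = j then u (e j) else 0)"
      using e j by (intro sum.cong) (auto simp: orthonormal_family_def)
    also have "\<dots> = u (e j)" using j by simp
    finally show False using uv(2) j by simp
  qed
qed

text \<open>Gram-Schmidt, with care for isotropic vectors: the orthogonal complement of the family is nonzero
  and the form is nondegenerate on it, so by polarization some vector \<open>z\<close> there has
  \<open>\<beta> z z \<noteq> 0\<close>; dividing by a complex square root normalizes it.\<close>

lemma orthonormal_family_extend:
  fixes scale :: "complex \<Rightarrow> 'v::ab_group_add \<Rightarrow> 'v"
  assumes "vector_space scale"
    and \<beta>: "bilinear_form scale \<beta>" "symmetric_form \<beta>" "nondegenerate_form \<beta>"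
    and e: "orthonormal_family \<beta> m e" and v: "v \<noteq> (\<Sum>i<m. scale (\<beta> v (e i)) (e i))"
  shows "\<exists>x. orthonormal_family \<beta> (Suc m) (e(m := x))"
proof -
  interpret vector_space scale by fact
  note simps = bilinear_form_simps[OF \<beta>(1)]
  have sym: "\<beta> x y = \<beta> y x" for x y using \<beta>(2) by (simp add: symmetric_form_def)
  define P where "P x = x - (\<Sum>i<m. scale (\<beta> x (e i)) (e i))" for x
  have P: "\<beta> (P x) (e j) = 0" if "j < m" for x j
  proof -
    have "(\<Sum>i<m. \<beta> x (e i) * \<beta> (e i) (e j)) = (\<Sum>i<m. if i = j then \<beta> x (e j) else 0)"
      using e that by (intro sum.cong) (auto simp: orthonormal_family_def)
    then show ?thesis using that by (simp add: P_def simps)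
  qed
  have PP: "\<beta> (P x) (P y) = \<beta> (P x) y" for x y
    using P by (subst (2) P_def) (simp add: simps)
  have "P v \<noteq> 0" using v by (simp add: P_def)
  then obtain y where y: "\<beta> (P v) y \<noteq> 0"
    using \<beta>(3) by (auto simp: nondegenerate_form_def)
  have Padd: "P (x + y) = P x + P y" for x y
    by (simp add: P_def simps scale_left_distrib sum.distrib)
  obtain z where z: "\<beta> (P z) (P z) \<noteq> 0"
  proof (rule ccontr)
    assume "\<not> thesis"
    with that have 0: "\<beta> (P z) (P z) = 0" for z by auto
    have "0 = \<beta> (P (v + y)) (P (v + y))" using 0 by simp
    also have "\<dots> = 2 * \<beta> (P v) (P y)"
      using 0[of v] 0[of y] by (simp add: Padd simps sym[of "P y" "P v"])
    finally show False using y by (simp add: PP)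
  qed
  define c where "c = inverse (csqrt (\<beta> (P z) (P z)))"
  have c: "c * (c * \<beta> (P z) (P z)) = 1"
  proof -
    have "csqrt (\<beta> (P z) (P z)) * csqrt (\<beta> (P z) (P z)) = \<beta> (P z) (P z)"
      by (metis power2_csqrt power2_eq_square)
    moreover have "csqrt (\<beta> (P z) (P z)) \<noteq> 0" using z by simp
    ultimately show ?thesis by (simp add: c_def field_simps)
  qed
  have "orthonormal_family \<beta> (Suc m) (e(m := scale c (P z)))"
    using e P c by (auto simp: orthonormal_family_def less_Suc_eq simps sym[of "e _" "P _"])
  then show ?thesis ..
qed

text \<open>Orthonormal families are independent, so there is one of maximal size; as it cannot be extended, every
  vector equals its expansion in it.\<close>

lemma ex_orthonormal_basis:
  fixes scale :: "complex \<Rightarrow> 'v::ab_group_add \<Rightarrow> 'v"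
  assumes fd: "finite_dimensional_vector_space scale Basis"
    and dim: "vector_space.dim scale (UNIV :: 'v set) = k"
    and \<beta>: "bilinear_form scale \<beta>" "symmetric_form \<beta>" "nondegenerate_form \<beta>"
  shows "\<exists>e. orthonormal_basis scale \<beta> e k"
proof -
  interpret finite_dimensional_vector_space scale Basis by fact
  have vs: "vector_space scale" by unfold_locales
  have bound: "m \<le> k" if "orthonormal_family \<beta> m e" for m e
  proof -
    note ind = orthonormal_family_independent[OF vs \<beta>(1) that]
    have "card (e ` {..<m}) \<le> dim (UNIV :: 'v set)"
      using ind(2) by (intro independent_card_le_dim) auto
    then show ?thesis using ind(1) dim by (simp add: card_image)
  qed
  define m where "m = Max {m. \<exists>e. orthonormal_family \<beta> m e}"
  have fin: "finite {m. \<exists>e. orthonormal_family \<beta> m e}"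
    using bound by (intro finite_subset[OF _ finite_atMost[of k]]) auto
  have "orthonormal_family \<beta> 0 e" for e by (simp add: orthonormal_family_def)
  then have "{m. \<exists>e. orthonormal_family \<beta> m e} \<noteq> {}" by auto
  with fin have "m \<in> {m. \<exists>e. orthonormal_family \<beta> m e}" unfolding m_def by (rule Max_in)
  then obtain e where e: "orthonormal_family \<beta> m e" by auto
  have expand: "x = (\<Sum>i<m. scale (\<beta> x (e i)) (e i))" for x
  proof (rule ccontr)
    assume "x \<noteq> (\<Sum>i<m. scale (\<beta> x (e i)) (e i))"
    then obtain y where "orthonormal_family \<beta> (Suc m) (e(m := y))"
      using orthonormal_family_extend[OF vs \<beta> e] by auto
    then have "Suc m \<le> m" unfolding m_def using fin by (intro Max_ge) auto
    then show False by simp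
  qed
  note ind = orthonormal_family_independent[OF vs \<beta>(1) e]
  have "x \<in> span (e ` {..<m})" for x
    by (subst expand, intro span_sum span_scale span_base) auto
  then have "span (e ` {..<m}) = span UNIV" by auto
  then have "dim (UNIV :: 'v set) = card (e ` {..<m})" using ind(2) by (rule dim_eq_card)
  then have "k = m" using ind(1) dim by (simp add: card_image)
  show ?thesis
  proof (intro exI[of _ e] orthonormal_basis.intro orthonormal_basis_axioms.intro)
    show "\<beta> (e i) (e j) = (if i = j then 1 else 0)" if "i < k" "j < k" for i j
      using e that \<open>k = m\<close> by (simp add: orthonormal_family_def)
    show "x = (\<Sum>i<k. scale (\<beta> x (e i)) (e i))" for x
      using expand \<open>k = m\<close> by simp
  qed (fact vs \<beta>)+
qed

context orthonormal_basis
begin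

lemmas beta_simps = bilinear_form_simps[OF bilinear]

lemma beta_sym: "\<beta> x y = \<beta> y x"
  using symmetric by (simp add: symmetric_form_def)

abbreviation dual :: "nat \<Rightarrow> 'v \<Rightarrow> complex" where
  "dual i \<equiv> (\<lambda>x. \<beta> x (e i))"

abbreviation linear_functional :: "('v \<Rightarrow> complex) \<Rightarrow> bool" where
  "linear_functional \<phi> \<equiv> Vector_Spaces.linear scale (*) \<phi>"

lemma beta_expansion: "\<beta> x y = (\<Sum>i<k. \<beta> x (e i) * \<beta> y (e i))"
  by (subst expansion[of y]) (simp add: beta_simps mult.commute)

lemma linear_functionalI:
  assumes "\<And>x y. \<phi> (x + y) = \<phi> x + \<phi> y" "\<And>c x. \<phi> (scale c x) = c * \<phi> x"
  shows "linear_functional \<phi>"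
  by unfold_locales (auto simp: assms algebra_simps)

lemma linear_functional_simps:
  assumes "linear_functional \<phi>"
  shows "\<phi> (x + y) = \<phi> x + \<phi> y" "\<phi> (scale c x) = c * \<phi> x"
    "\<phi> (sum f A) = (\<Sum>a\<in>A. \<phi> (f a))"
proof -
  interpret Vector_Spaces.linear scale "(*)" \<phi> by fact
  show "\<phi> (x + y) = \<phi> x + \<phi> y" "\<phi> (scale c x) = c * \<phi> x"
    "\<phi> (sum f A) = (\<Sum>a\<in>A. \<phi> (f a))" by (rule add scale sum)+
qed

lemma linear_dual: "linear_functional (dual i)"
  by (rule linear_functionalI) (simp_all add: beta_simps)

lemma functional_expansion:
  assumes "linear_functional \<phi>"
  shows "\<phi> = (\<lambda>x. \<Sum>i<k. \<phi> (e i) * dual i x)"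
proof
  fix x
  show "\<phi> x = (\<Sum>i<k. \<phi> (e i) * dual i x)"
    by (subst expansion[of x]) (simp add: linear_functional_simps[OF assms] mult.commute)
qed

lemma linear_functional_comp:
  assumes "Vector_Spaces.linear scale scale g" "bij g"
  shows "linear_functional (\<phi> \<circ> g) \<longleftrightarrow> linear_functional \<phi>"
proof -
  interpret g: Vector_Spaces.linear scale scale g by fact
  define h where "h = inv_into UNIV g"
  have surj: "g (h y) = y" for y
    using assms(2) by (simp add: h_def bij_is_surj surj_f_inv_f)
  show ?thesis
  proof
    assume l: "linear_functional (\<phi> \<circ> g)"
    show "linear_functional \<phi>"
    proof (rule linear_functionalI)
      fix x y c
      show "\<phi> (x + y) = \<phi> x + \<phi> y"
        using linear_functional_simps(1)[OF l, of "h x" "h y"] by (simp add: g.add surj)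
      show "\<phi> (scale c x) = c * \<phi> x"
        using linear_functional_simps(2)[OF l, of c "h x"] by (simp add: g.scale surj)
    qed
  next
    assume "linear_functional \<phi>"
    then show "linear_functional (\<phi> \<circ> g)"
      by (intro linear_functionalI) (simp_all add: g.add g.scale linear_functional_simps)
  qed
qed

section \<open>Isometries and plane rotations\<close>

definition basis_list :: "'v list" where
  "basis_list = map e [0..<k]"

definition basis_matrix :: "('v \<Rightarrow> 'v) \<Rightarrow> complex mat" where
  "basis_matrix g = mat k k (\<lambda>(i, j). \<beta> (g (e j)) (e i))"

lemma orthonormal_family: "orthonormal_family \<beta> k e"
  using orthonormal by (simp add: orthonormal_family_def)

lemma inj_e: "inj_on e {..<k}" and independent_e: "\<not> dependent (e ` {..<k})"
  using orthonormal_family_independent[OF vector_space_axioms bilinear orthonormal_family]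
  by simp_all

lemma span_e: "span (e ` {..<k}) = UNIV"
proof -
  have "x \<in> span (e ` {..<k})" for x
    by (subst expansion, intro span_sum span_scale span_base) auto
  then show ?thesis by auto
qed

lemma ordered_basis_list: "ordered_basis scale basis_list"
  using inj_e independent_e span_e
  by (simp add: ordered_basis_def basis_list_def distinct_map atLeast0LessThan)

lemma representation_e:
  assumes "i < k"
  shows "representation (e ` {..<k}) x (e i) = \<beta> x (e i)"
proof -
  have "representation (e ` {..<k}) x (e i) =
      representation (e ` {..<k}) (\<Sum>j<k. scale (\<beta> x (e j)) (e j)) (e i)"
    using expansion[of x] by simp
  also have "\<dots> = (\<Sum>j<k. \<beta> x (e j) * representation (e ` {..<k}) (e j) (e i))"
    using independent_e span_e by (simp add: representation_sum representation_scale)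
  also have "\<dots> = (\<Sum>j<k. if j = i then \<beta> x (e i) else 0)"
    using independent_e inj_e assms
    by (intro sum.cong) (auto simp: representation_basis inj_on_def)
  finally show ?thesis using assms by simp
qed

lemma operator_det_basis_matrix:
  assumes "Vector_Spaces.linear scale scale g"
  shows "operator_det scale g = det (basis_matrix g)"
proof -
  have "operator_matrix scale basis_list g = basis_matrix g"
    unfolding operator_matrix_def basis_matrix_def
    by (rule cong_mat) (auto simp: basis_list_def representation_e atLeast0LessThan)
  with operator_det_eq[OF ordered_basis_list assms] show ?thesis by simp
qed

lemma basis_matrix_carrier: "basis_matrix g \<in> carrier_mat k k"
  by (simp add: basis_matrix_def)

lemma basis_matrix_comp:
  assumes "Vector_Spaces.linear scale scale g"
  shows "basis_matrix (g \<circ> h) = basis_matrix g * basis_matrix h"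
proof (rule eq_matI)
  interpret g: Vector_Spaces.linear scale scale g by fact
  fix i j assume "i < dim_row (basis_matrix g * basis_matrix h)" "j < dim_col (basis_matrix g * basis_matrix h)"
  then have ij: "i < k" "j < k" by (simp_all add: basis_matrix_def)
  have "\<beta> (g (h (e j))) (e i) = \<beta> (g (\<Sum>l<k. scale (\<beta> (h (e j)) (e l)) (e l))) (e i)"
    using expansion[of "h (e j)"] by simp
  also have "\<dots> = (\<Sum>l<k. \<beta> (g (e l)) (e i) * \<beta> (h (e j)) (e l))"
    by (simp add: g.sum g.scale beta_simps mult.commute)
  finally show "basis_matrix (g \<circ> h) $$ (i, j) = (basis_matrix g * basis_matrix h) $$ (i, j)"
    using ij by (simp add: basis_matrix_def scalar_prod_def atLeast0LessThan)
qed (simp_all add: basis_matrix_def)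

definition isometry :: "('v \<Rightarrow> 'v) \<Rightarrow> bool" where
  "isometry g \<longleftrightarrow> Vector_Spaces.linear scale scale g \<and> bij g \<and> (\<forall>x y. \<beta> (g x) (g y) = \<beta> x y)"

lemma basis_matrix_isometry:
  assumes "isometry g"
  shows "(basis_matrix g)\<^sup>T * basis_matrix g = 1\<^sub>m k" and "basis_matrix g * (basis_matrix g)\<^sup>T = 1\<^sub>m k"
proof -
  show 1: "(basis_matrix g)\<^sup>T * basis_matrix g = 1\<^sub>m k"
  proof (rule eq_matI)
    fix i j assume "i < dim_row (1\<^sub>m k :: complex mat)" "j < dim_col (1\<^sub>m k :: complex mat)"
    then have ij: "i < k" "j < k" by simp_all
    have "\<beta> (g (e i)) (g (e j)) = (if i = j then 1 else 0)"
      using assms orthonormal ij by (simp add: isometry_def)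
    then show "((basis_matrix g)\<^sup>T * basis_matrix g) $$ (i, j) = 1\<^sub>m k $$ (i, j)"
      using ij by (simp add: basis_matrix_def scalar_prod_def atLeast0LessThan
          beta_expansion[of "g (e i)" "g (e j)"])
  qed (simp_all add: basis_matrix_def)
  show "basis_matrix g * (basis_matrix g)\<^sup>T = 1\<^sub>m k"
    by (rule mat_mult_left_right_inverse[OF _ _ 1]) (simp_all add: basis_matrix_carrier)
qed

text \<open>An isometry has determinant \<open>1\<close> or \<open>- 1\<close>, so its square is special. This spares every
  determinant computation for rotations: a rotation is the square of the rotation by half the angle.\<close>

lemma isometry_square_special:
  assumes g: "isometry g"
  shows "g \<circ> g \<in> special_orthogonal_group scale \<beta>"
proof -
  have lin: "Vector_Spaces.linear scale scale g" and bij: "bij g" using g by (simp_all add: isometry_def)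
  have lin2: "Vector_Spaces.linear scale scale (g \<circ> g)" by (rule Vector_Spaces.linear_compose[OF lin lin])
  have "det ((basis_matrix g)\<^sup>T * basis_matrix g) = 1" by (simp add: basis_matrix_isometry[OF g])
  then have "det (basis_matrix g) * det (basis_matrix g) = 1"
    using det_mult[of "(basis_matrix g)\<^sup>T" k "basis_matrix g"]
    by (simp add: basis_matrix_carrier det_transpose[OF basis_matrix_carrier])
  then have "operator_det scale (g \<circ> g) = 1"
    by (simp add: operator_det_basis_matrix[OF lin2] basis_matrix_comp[OF lin]
        det_mult[OF basis_matrix_carrier basis_matrix_carrier])
  with lin2 bij g show ?thesis
    by (auto simp: special_orthogonal_group_def isometry_def bij_comp simp del: comp_apply)
       (simp add: comp_def)
qed

lemma special_orthogonal_isometry: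
  "g \<in> special_orthogonal_group scale \<beta> \<longleftrightarrow> isometry g \<and> det (basis_matrix g) = 1"
  by (auto simp: special_orthogonal_group_def isometry_def operator_det_basis_matrix)

text \<open>The rotation with cosine \<open>a\<close> and sine \<open>b\<close> in the plane of \<open>e j\<close> and \<open>e (Suc j)\<close>; both are complex
  numbers here.\<close>

definition plane_rotation :: "nat \<Rightarrow> complex \<Rightarrow> complex \<Rightarrow> 'v \<Rightarrow> 'v" where
  "plane_rotation j a b x = x
     + scale ((a - 1) * dual j x - b * dual (Suc j) x) (e j)
     + scale (b * dual j x + (a - 1) * dual (Suc j) x) (e (Suc j))"

lemma plane_rotation_dual:
  assumes "Suc j < k" "i < k"
  shows "dual i (plane_rotation j a b x) =
    (if i = j then a * dual j x - b * dual (Suc j) x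
     else if i = Suc j then b * dual j x + a * dual (Suc j) x else dual i x)"
  using assms by (simp add: plane_rotation_def beta_simps orthonormal algebra_simps)

lemma eq_by_duals:
  assumes "\<And>i. i < k \<Longrightarrow> dual i x = dual i y"
  shows "x = y"
  by (subst expansion[of x], subst expansion[of y]) (simp add: assms)

lemma plane_rotation_isometry:
  assumes j: "Suc j < k" and ab: "a * a + b * b = 1"
  shows "isometry (plane_rotation j a b)"
proof -
  have inv: "plane_rotation j a b (plane_rotation j a (- b) x) = x" if "a * a + b * b = 1" for a b x
  proof (rule eq_by_duals)
    fix i assume i: "i < k"
    have *: "a * (a * s + b * t) - b * (a * t - b * s) = (a * a + b * b) * s"
      "b * (a * s + b * t) + a * (a * t - b * s) = (a * a + b * b) * t" for s t
      by (simp_all add: algebra_simps)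
    show "dual i (plane_rotation j a b (plane_rotation j a (- b) x)) = dual i x"
      using i j * that by (simp add: plane_rotation_dual)
  qed
  have "bij (plane_rotation j a b)"
    using inv[of a b] inv[of a "- b"] ab by (intro o_bij[of "plane_rotation j a (- b)"]) (auto simp: fun_eq_iff)
  moreover have "Vector_Spaces.linear scale scale (plane_rotation j a b)"
    by unfold_locales (simp_all add: plane_rotation_def beta_simps algebra_simps scale_left_distrib
        scale_right_distrib scale_left_diff_distrib scale_right_diff_distrib)
  moreover have "\<beta> (plane_rotation j a b x) (plane_rotation j a b y) = \<beta> x y" for x y
  proof -
    let ?I = "{..<k} - {j, Suc j}"
    have rest: "(\<Sum>i\<in>?I. dual i (plane_rotation j a b x) * dual i (plane_rotation j a b y)) =
      (\<Sum>i\<in>?I. dual i x * dual i y)"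
      using j by (intro sum.cong) (auto simp: plane_rotation_dual)
    have id: "(a * s - b * t) * (a * s' - b * t') + (b * s + a * t) * (b * s' + a * t') = s * s' + t * t'"
      for s t s' t'
    proof -
      have "(a * s - b * t) * (a * s' - b * t') + (b * s + a * t) * (b * s' + a * t') =
        (a * a + b * b) * (s * s' + t * t')" by (simp add: algebra_simps)
      then show ?thesis by (simp add: ab)
    qed
    show ?thesis
      unfolding beta_expansion[of x y] beta_expansion[of "plane_rotation j a b x" "plane_rotation j a b y"] sum_split_plane[OF j] rest
      using j by (simp add: plane_rotation_dual id)
  qed
  ultimately show ?thesis by (simp add: isometry_def)
qed

end

section \<open>Multilinearity of tensors\<close>

context orthonormal_basis
begin

interpretation T: vector_space "tensor_scale :: complex \<Rightarrow> ('v, complex) tensor \<Rightarrow> ('v, complex) tensor"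
  by (rule vector_space_tensor_scale)

lemma tensor_power_induct [consumes 1, case_names zero pure add]:
  assumes "F \<in> tensor_power scale n"
    and "P 0"
    and "\<And>c vs. length vs = n \<Longrightarrow> P (tensor_scale c (pure_tensor scale vs))"
    and "\<And>F G. P F \<Longrightarrow> P G \<Longrightarrow> P (F + G)"
  shows "P F"
  using assms(1) unfolding tensor_power_def
proof (induction rule: T.span_induct_alt)
  case base
  show ?case by (rule assms(2))
next
  case (step c x y)
  then obtain vs where "length vs = n" "x = pure_tensor scale vs" by blast
  then have "P (tensor_scale c x)" using assms(3) by blast
  then show ?case using step.IH by (rule assms(4))
qed

text \<open>A tensor is by definition a function of lists of functionals, so coordinates with respect to any
  basis of the dual space are just its values. The functionals in \<open>us\<close> and \<open>ws\<close> may be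
  arbitrary: if one of them is not linear, all three values vanish.\<close>

lemma tensor_multilinear:
  assumes F: "F \<in> tensor_power scale n" and lin: "linear_functional \<phi>" "linear_functional \<psi>"
  shows "F (us @ (\<lambda>x. a * \<phi> x + b * \<psi> x) # ws) = a * F (us @ \<phi> # ws) + b * F (us @ \<psi> # ws)"
  using F
proof (induction rule: tensor_power_induct)
  case (pure c vs)
  define m where "m = length us"
  have ab: "linear_functional (\<lambda>x. a * \<phi> x + b * \<psi> x)"
    using lin by (intro linear_functionalI) (simp_all add: linear_functional_simps algebra_simps)
  have *: "pure_tensor scale vs (us @ \<chi> # ws) =
    (if length vs = Suc (length us + length ws) \<and> (\<forall>\<phi>\<in>set us \<union> set ws. linear_functional \<phi>)
     then \<chi> (vs ! m) * (\<Prod>i\<in>{..<length vs} - {m}. ((us @ \<phi> # ws) ! i) (vs ! i)) else 0)"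
    if "linear_functional \<chi>" for \<chi>
  proof (cases "length vs = Suc (length us + length ws)")
    case True
    have "(\<Prod>i<length vs. ((us @ \<chi> # ws) ! i) (vs ! i)) =
      ((us @ \<chi> # ws) ! m) (vs ! m) * (\<Prod>i\<in>{..<length vs} - {m}. ((us @ \<chi> # ws) ! i) (vs ! i))"
      using True by (intro prod.remove) (auto simp: m_def)
    also have "(\<Prod>i\<in>{..<length vs} - {m}. ((us @ \<chi> # ws) ! i) (vs ! i)) =
      (\<Prod>i\<in>{..<length vs} - {m}. ((us @ \<phi> # ws) ! i) (vs ! i))"
      by (intro prod.cong) (auto simp: m_def nth_append nth_Cons split: nat.split)
    also have "(us @ \<chi> # ws) ! m = \<chi>" by (simp add: m_def)
    finally show ?thesis using that True by (auto simp: pure_tensor_def)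
  qed (auto simp: pure_tensor_def)
  show ?case by (simp add: tensor_scale_def *[OF ab] *[OF lin(1)] *[OF lin(2)] algebra_simps)
qed (simp_all add: algebra_simps)

lemma tensor_scaled:
  assumes "F \<in> tensor_power scale n" "linear_functional \<phi>"
  shows "F (us @ (\<lambda>x. a * \<phi> x) # ws) = a * F (us @ \<phi> # ws)"
  using tensor_multilinear[OF assms assms(2), of us a 0 ws] by simp

lemma linear_functional_combination:
  assumes "\<And>i. i \<in> I \<Longrightarrow> linear_functional (b i)"
  shows "linear_functional (\<lambda>x. \<Sum>i\<in>I. c i * b i x)"
  using assms by (intro linear_functionalI)
    (auto simp: linear_functional_simps algebra_simps sum.distrib sum_distrib_left intro!: sum.cong)

lemma tensor_combination:
  assumes F: "F \<in> tensor_power scale n" and I: "finite I" "\<And>i. i \<in> I \<Longrightarrow> linear_functional (b i)"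
  shows "F (us @ (\<lambda>x. \<Sum>i\<in>I. c i * b i x) # ws) = (\<Sum>i\<in>I. c i * F (us @ b i # ws))"
  using I
proof (induction I)
  case empty
  have "linear_functional (\<lambda>x. 0)" by (rule linear_functionalI) simp_all
  from tensor_scaled[OF F this, of us 0 ws] show ?case by simp
next
  case (insert i I)
  then have "linear_functional (b i)" "linear_functional (\<lambda>x. \<Sum>i\<in>I. c i * b i x)"
    by (auto intro!: linear_functional_combination)
  from tensor_multilinear[OF F this, of us "c i" 1 ws] insert show ?case by simp
qed

lemma tensor_eigen:
  assumes F: "F \<in> tensor_power scale n" and b: "\<And>i. i \<in> set s \<Longrightarrow> linear_functional (b i)"
  shows "F (us @ map (\<lambda>i x. c i * b i x) s) = prod_list (map c s) * F (us @ map b s)"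
  using b
proof (induction s arbitrary: us)
  case (Cons i s)
  have "F (us @ map (\<lambda>i x. c i * b i x) (i # s)) = c i * F ((us @ [b i]) @ map (\<lambda>i x. c i * b i x) s)"
    using tensor_scaled[OF F, of "b i" us "c i"] Cons.prems by simp
  also have "\<dots> = c i * (prod_list (map c s) * F ((us @ [b i]) @ map b s))"
    using Cons.prems by (subst Cons.IH) auto
  finally show ?case by simp
qed simp

definition functional_basis :: "(nat \<Rightarrow> 'v \<Rightarrow> complex) \<Rightarrow> bool" where
  "functional_basis b \<longleftrightarrow> (\<forall>i<k. linear_functional (b i)) \<and>
     (\<forall>\<phi>. linear_functional \<phi> \<longrightarrow> (\<exists>c. \<phi> = (\<lambda>x. \<Sum>i<k. c i * b i x)))"

lemma functional_basis_dual: "functional_basis dual"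
  unfolding functional_basis_def
proof (intro conjI allI impI linear_dual)
  fix \<phi> assume "linear_functional \<phi>"
  then show "\<exists>c. \<phi> = (\<lambda>x. \<Sum>i<k. c i * dual i x)"
    by (intro exI[of _ "\<lambda>i. \<phi> (e i)"]) (rule functional_expansion)
qed

text \<open>The prefix \<open>us\<close> is kept apart so that coordinates in two different bases can be mixed: one basis for
  the first slots, another one for the rest.\<close>

lemma tensor_vanish:
  assumes F: "F \<in> tensor_power scale n" and b: "functional_basis b"
    and zero: "\<And>s. s \<in> words k (length \<phi>s) \<Longrightarrow> F (us @ map b s) = 0"
    and lin: "\<And>\<phi>. \<phi> \<in> set \<phi>s \<Longrightarrow> linear_functional \<phi>"
  shows "F (us @ \<phi>s) = 0"
  using zero lin
proof (induction \<phi>s arbitrary: us)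
  case Nil
  then show ?case by (simp add: words_def)
next
  case (Cons \<phi> \<phi>s)
  obtain c where c: "\<phi> = (\<lambda>x. \<Sum>i<k. c i * b i x)"
    using b Cons.prems(2)[of \<phi>] by (auto simp: functional_basis_def)
  have "F (us @ \<phi> # \<phi>s) = (\<Sum>i<k. c i * F (us @ b i # \<phi>s))"
    unfolding c using b by (intro tensor_combination[OF F]) (auto simp: functional_basis_def)
  also have "\<dots> = 0"
  proof (rule sum.neutral, clarify)
    fix i assume "i < k"
    have "F ((us @ [b i]) @ \<phi>s) = 0"
    proof (rule Cons.IH)
      fix s assume "s \<in> words k (length \<phi>s)"
      then have "i # s \<in> words k (length (\<phi> # \<phi>s))" using \<open>i < k\<close> by (auto simp: words_def)
      from Cons.prems(1)[OF this] show "F ((us @ [b i]) @ map b s) = 0" by simp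
    qed (use Cons.prems(2) in auto)
    then show "c i * F (us @ b i # \<phi>s) = 0" by simp
  qed
  finally show ?case .
qed

lemma tensor_support:
  assumes F: "F \<in> tensor_power scale n"
    and \<phi>s: "\<not> (length \<phi>s = n \<and> (\<forall>\<phi>\<in>set \<phi>s. linear_functional \<phi>))"
  shows "F \<phi>s = 0"
  using F
proof (induction rule: tensor_power_induct)
  case (pure c vs)
  then have "pure_tensor scale vs \<phi>s = 0"
    unfolding pure_tensor_def using \<phi>s by (intro if_not_P) blast
  then show ?case by (simp add: tensor_scale_def)
qed simp_all

lemma tensor_eq_0I:
  assumes F: "F \<in> tensor_power scale n" and zero: "\<And>s. s \<in> words k n \<Longrightarrow> F (map dual s) = 0"
  shows "F = 0"
proof
  fix \<phi>s
  show "F \<phi>s = 0 \<phi>s"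
  proof (cases "length \<phi>s = n \<and> (\<forall>\<phi>\<in>set \<phi>s. linear_functional \<phi>)")
    case True
    have "F ([] @ \<phi>s) = 0"
    proof (rule tensor_vanish[OF F functional_basis_dual])
      show "F ([] @ map dual s) = 0" if "s \<in> words k (length \<phi>s)" for s
        using zero[of s] that True by simp
      show "linear_functional \<phi>" if "\<phi> \<in> set \<phi>s" for \<phi>
        using True that by blast
    qed
    then show ?thesis by simp
  next
    case False
    from tensor_support[OF F False] show ?thesis by simp
  qed
qed

section \<open>The least word of an invariant tensor\<close>

abbreviation invariants :: "nat \<Rightarrow> ('v, complex) tensor set" where
  "invariants n \<equiv> tensor_invariants scale (special_orthogonal_group scale \<beta>) n"

text \<open>A simultaneous eigenbasis of an element \<open>g\<close> of the group diagonalizes its action on tensors, so an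
  invariant tensor can only have nonzero coordinates at words of total eigenvalue \<open>1\<close>.\<close>

lemma invariant_eigen:
  assumes F: "F \<in> invariants n" and g: "g \<in> special_orthogonal_group scale \<beta>"
    and b: "\<And>i. i < k \<Longrightarrow> linear_functional (b i)" "\<And>i x. i < k \<Longrightarrow> b i (g x) = c i * b i x"
    and s: "s \<in> words k n" and nz: "F (map b s) \<noteq> 0"
  shows "prod_list (map c s) = 1"
proof -
  have FT: "F \<in> tensor_power scale n" and "tensor_map g F = F"
    using F g by (auto simp: tensor_invariants_def)
  then have "F (map b s) = tensor_map g F (map b s)" by simp
  also have "\<dots> = F (map (\<lambda>i x. c i * b i x) s)"
    using s b(2) unfolding tensor_map_def by (intro arg_cong[of _ _ F]) (auto simp: words_def fun_eq_iff)
  also have "\<dots> = prod_list (map c s) * F (map b s)"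
    using tensor_eigen[OF FT, of s b "[]" c] s b(1) by (auto simp: words_def)
  finally show ?thesis using nz by simp
qed

lemma prod_list_two_letters:
  "prod_list (map (\<lambda>i. if i = j then x else if i = Suc j then y else 1) s) =
     (x ^ count_list s j * y ^ count_list s (Suc j) :: complex)"
  by (induction s) auto

text \<open>The rotation by a half turn in the plane of \<open>e j\<close> and \<open>e (Suc j)\<close> multiplies a coordinate by \<open>- 1\<close>
  for each letter \<open>j\<close> or \<open>Suc j\<close>. It is the square of the quarter turn.\<close>

lemma invariant_same_parity:
  assumes F: "F \<in> invariants n" and w: "w \<in> words k n" and nz: "F (map dual w) \<noteq> 0"
  shows "same_parity_word k w"
proof -
  have step: "even (count_list w j) = even (count_list w (Suc j))" if j: "Suc j < k" for j
  proof -
    let ?g = "plane_rotation j 0 1 \<circ> plane_rotation j 0 1"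
    let ?c = "\<lambda>i. if i = j then -1 else if i = Suc j then -1 else 1 :: complex"
    have "?g \<in> special_orthogonal_group scale \<beta>"
      by (intro isometry_square_special plane_rotation_isometry j) simp
    then have "prod_list (map ?c w) = 1"
      by (rule invariant_eigen[OF F _ linear_dual _ w nz]) (simp add: plane_rotation_dual j Suc_lessD)
    then have "(-1 :: complex) ^ (count_list w j + count_list w (Suc j)) = 1"
      by (simp only: prod_list_two_letters power_add)
    then have "even (count_list w j + count_list w (Suc j))"
      by (metis neg_one_odd_power one_neq_neg_one)
    then show ?thesis by simp
  qed
  have "even (count_list w i) = even (count_list w 0)" if "i < k" for i
    using that by (induction i) (auto simp: step)
  then show ?thesis unfolding same_parity_word_def by blast
qed

text \<open>The eigenfunctionals of the rotations in the plane of \<open>e j\<close> and \<open>e (Suc j)\<close>: a rotation multiplies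
  the one with index \<open>j\<close> by \<open>a + \<i> * b\<close> and the one with index \<open>Suc j\<close> by the inverse.\<close>

definition isotropic :: "nat \<Rightarrow> nat \<Rightarrow> 'v \<Rightarrow> complex" where
  "isotropic j i = (\<lambda>x. if i = j then dual j x + \<i> * dual (Suc j) x
     else if i = Suc j then dual j x - \<i> * dual (Suc j) x else dual i x)"

definition excess :: "nat \<Rightarrow> nat list \<Rightarrow> int" where
  "excess j u = int (count_list u j) - int (count_list u (Suc j))"

lemma linear_isotropic: "linear_functional (isotropic j i)"
  by (rule linear_functionalI) (simp_all add: isotropic_def beta_simps algebra_simps)

lemma functional_basis_isotropic:
  assumes j: "Suc j < k"
  shows "functional_basis (isotropic j)"
  unfolding functional_basis_def
proof (intro conjI allI impI linear_isotropic)
  fix \<phi> assume "linear_functional \<phi>"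
  define c where "c i = \<phi> (e i)" for i
  have c: "\<phi> = (\<lambda>x. \<Sum>i<k. c i * dual i x)"
    unfolding c_def using \<open>linear_functional \<phi>\<close> by (rule functional_expansion)
  define c' where "c' i = (if i = j then (c j - \<i> * c (Suc j)) / 2
    else if i = Suc j then (c j + \<i> * c (Suc j)) / 2 else c i)" for i
  have "\<phi> x = (\<Sum>i<k. c' i * isotropic j i x)" for x
  proof -
    have "(\<Sum>i\<in>{..<k} - {j, Suc j}. c' i * isotropic j i x) = (\<Sum>i\<in>{..<k} - {j, Suc j}. c i * dual i x)"
      by (intro sum.cong) (auto simp: c'_def isotropic_def)
    then show ?thesis
      unfolding c sum_split_plane[OF j] by (simp add: c'_def isotropic_def field_simps)
  qed
  then show "\<exists>c. \<phi> = (\<lambda>x. \<Sum>i<k. c i * isotropic j i x)"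
    by (intro exI[of _ c'] ext)
qed

text \<open>Take a rotation with eigenvalues \<open>4\<close> and \<open>1/4\<close>. It is the square of the one with eigenvalues \<open>2\<close>
  and \<open>1/2\<close>, which has cosine \<open>(2 + 1/2) / 2\<close> and sine \<open>(2 - 1/2) / (2 * \<i>)\<close>. As \<open>4\<close> is not a root
  of unity, the total eigenvalue is \<open>1\<close> only if both functionals occur equally often.\<close>

lemma invariant_excess_0:
  assumes F: "F \<in> invariants n" and s: "s \<in> words k n" and j: "Suc j < k"
    and nz: "F (map (isotropic j) s) \<noteq> 0"
  shows "excess j s = 0"
proof -
  let ?h = "plane_rotation j (5/4) (- (3/4) * \<i>)"
  let ?c = "\<lambda>i. if i = j then 4 else if i = Suc j then 1/4 else 1 :: complex"
  have g: "?h \<circ> ?h \<in> special_orthogonal_group scale \<beta>"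
    by (intro isometry_square_special plane_rotation_isometry j) (simp add: field_simps)
  have "prod_list (map ?c s) = 1"
    by (rule invariant_eigen[OF F g linear_isotropic _ s nz])
      (simp add: plane_rotation_dual j Suc_lessD isotropic_def field_simps)
  then have "(4 :: complex) ^ count_list s j * (1/4) ^ count_list s (Suc j) = 1"
    by (simp only: prod_list_two_letters)
  then have "(4 :: complex) ^ count_list s j = 4 ^ count_list s (Suc j)"
    by (simp add: field_simps power_divide)
  then have "of_nat (4 ^ count_list s j) = (of_nat (4 ^ count_list s (Suc j)) :: complex)" by simp
  then have "(4 :: nat) ^ count_list s j = 4 ^ count_list s (Suc j)" by (rule of_nat_eq_iff[THEN iffD1])
  then show ?thesis by (simp add: excess_def)
qed

text \<open>Fix the first \<open>r\<close> slots to the letters of the least word \<open>w\<close> and expand the other slots in isotropic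
  functionals. Let the weight of a word in these be its excess. Initially only weight \<open>0\<close> occurs.
  Fixing a slot to a letter \<open>j\<close> averages the values at the two isotropic functionals, so it widens
  the range of weights by one on each side. Where \<open>w\<close> has a letter \<open>Suc j\<close>, the letter \<open>j\<close> would give
  a smaller word, so the value there is zero. Then the values at the two isotropic functionals
  agree up to sign, and as they come from weights that differ by two, both bounds apply to a
  nonzero value: the range shrinks by one on each side. So the weights are bounded by the excess
  of the prefix.\<close>

lemma excess_bound:
  assumes F: "F \<in> invariants n" and w: "w \<in> words k n" and j: "Suc j < k"
    and least: "\<And>u. u \<in> words k n \<Longrightarrow> u < w \<Longrightarrow> F (map dual u) = 0"
    and "r \<le> n" "s \<in> words k (n - r)" "F (map dual (take r w) @ map (isotropic j) s) \<noteq> 0"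
  shows "\<bar>excess j s\<bar> \<le> excess j (take r w)"
  using assms(5-)
proof (induction r arbitrary: s)
  case 0
  then show ?case using invariant_excess_0[OF F _ j] by (simp add: excess_def)
next
  case (Suc r)
  have FT: "F \<in> tensor_power scale n" using F by (simp add: tensor_invariants_def)
  have len: "length w = n" using w by (simp add: words_def)
  define i where "i = w ! r"
  define pre where "pre = map dual (take r w)"
  let ?S = "map (isotropic j) s"
  have ik: "i < k" using Suc.prems(1) wordsD[OF w] by (simp add: i_def)
  have take: "take (Suc r) w = take r w @ [i]"
    using Suc.prems(1) len by (simp add: i_def take_Suc_conv_app_nth)
  have nz: "F (pre @ dual i # ?S) \<noteq> 0" using Suc.prems(3) by (simp add: take pre_def)
  have IH: "\<bar>excess j (l # s)\<bar> \<le> excess j (take r w)"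
    if "l < k" "F (pre @ isotropic j l # ?S) \<noteq> 0" for l
    using that Suc.prems by (intro Suc.IH) (auto simp: words_def pre_def)
  consider "i \<noteq> j" "i \<noteq> Suc j" | "i = j" | "i = Suc j" by blast
  then show ?case
  proof cases
    case 1
    then have "dual i = isotropic j i" by (simp add: isotropic_def)
    with nz IH[OF ik] 1 show ?thesis by (simp add: take excess_def)
  next
    case 2
    have "dual j = (\<lambda>x. 1/2 * isotropic j j x + 1/2 * isotropic j (Suc j) x)"
      by (simp add: isotropic_def fun_eq_iff field_simps)
    then have "F (pre @ dual j # ?S) =
        1/2 * F (pre @ isotropic j j # ?S) + 1/2 * F (pre @ isotropic j (Suc j) # ?S)"
      using tensor_multilinear[OF FT linear_isotropic linear_isotropic] by metis
    with nz 2 have "F (pre @ isotropic j j # ?S) \<noteq> 0 \<or> F (pre @ isotropic j (Suc j) # ?S) \<noteq> 0"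
      by auto
    then show ?thesis using IH[of j] IH[of "Suc j"] j 2 by (auto simp: take excess_def)
  next
    case 3
    \<comment> \<open>replacing the letter \<open>Suc j\<close> by \<open>j\<close> gives words below \<open>w\<close>, whatever follows\<close>
    have "F ((pre @ [dual j]) @ ?S) = 0"
    proof (rule tensor_vanish[OF FT functional_basis_dual])
      fix t assume t: "t \<in> words k (length ?S)"
      define u where "u = take r w @ j # t"
      have u: "u \<in> words k n"
        using t w j Suc.prems(1,2) set_take_subset[of r w] by (auto simp: words_def u_def)
      moreover have "u < w"
      proof -
        have "take r u = take r w" "u ! r < w ! r"
          using 3 len Suc.prems(1) by (simp_all add: u_def nth_append i_def)
        then show ?thesis
          using u len Suc.prems(1) list_less_same_length[of u w] by (auto simp: words_def)
      qed
      ultimately have "F (map dual u) = 0" by (rule least)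
      then show "F ((pre @ [dual j]) @ map dual t) = 0" by (simp add: u_def pre_def)
    qed (auto simp: linear_isotropic)
    moreover have "dual j = (\<lambda>x. 1/2 * isotropic j j x + 1/2 * isotropic j (Suc j) x)"
      by (simp add: isotropic_def fun_eq_iff field_simps)
    ultimately have plus: "F (pre @ isotropic j j # ?S) + F (pre @ isotropic j (Suc j) # ?S) = 0"
      using tensor_multilinear[OF FT linear_isotropic linear_isotropic, of pre "1/2" j j "1/2" j "Suc j" ?S]
      by (simp add: add_divide_distrib[symmetric])
    have "dual (Suc j) = (\<lambda>x. - \<i>/2 * isotropic j j x + \<i>/2 * isotropic j (Suc j) x)"
      by (simp add: isotropic_def fun_eq_iff field_simps)
    then have "F (pre @ dual (Suc j) # ?S) =
        - \<i>/2 * F (pre @ isotropic j j # ?S) + \<i>/2 * F (pre @ isotropic j (Suc j) # ?S)"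
      using tensor_multilinear[OF FT linear_isotropic linear_isotropic] by metis
    with nz 3 plus have "F (pre @ isotropic j j # ?S) \<noteq> 0" "F (pre @ isotropic j (Suc j) # ?S) \<noteq> 0"
      by (auto simp: add_eq_0_iff)
    then show ?thesis using IH[of j] IH[of "Suc j"] j 3 by (auto simp: take excess_def)
  qed
qed

text \<open>Since \<open>F\<close> does not vanish at \<open>w\<close>, after every prefix of \<open>w\<close> some isotropic word gives a nonzero
  value. By \<open>excess_bound\<close> the prefix has nonnegative excess, which is the lattice condition.\<close>

lemma least_word_good:
  assumes F: "F \<in> invariants n" and w: "w \<in> words k n" and nz: "F (map dual w) \<noteq> 0"
    and least: "\<And>u. u \<in> words k n \<Longrightarrow> u < w \<Longrightarrow> F (map dual u) = 0"
  shows "w \<in> good_words k n"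
proof -
  have FT: "F \<in> tensor_power scale n" using F by (simp add: tensor_invariants_def)
  have len: "length w = n" using w by (simp add: words_def)
  have bound: "count_list (take r w) (Suc j) \<le> count_list (take r w) j" if r: "r \<le> n" for r j
  proof (cases "Suc j < k")
    case True
    have "\<exists>s\<in>words k (n - r). F (map dual (take r w) @ map (isotropic j) s) \<noteq> 0"
    proof (rule ccontr)
      assume neg: "\<not> ?thesis"
      have "F (map dual (take r w) @ map dual (drop r w)) = 0"
      proof (rule tensor_vanish[OF FT functional_basis_isotropic[OF True]])
        show "F (map dual (take r w) @ map (isotropic j) s) = 0"
          if "s \<in> words k (length (map dual (drop r w)))" for s
          using neg that len by simp
        show "linear_functional \<phi>" if "\<phi> \<in> set (map dual (drop r w))" for \<phi>
          using that linear_dual by (metis (no_types, lifting) imageE list.set_map)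
      qed
      then have "F (map dual (take r w @ drop r w)) = 0" by (simp only: map_append)
      with nz show False by (simp only: append_take_drop_id)
    qed
    then obtain s where "s \<in> words k (n - r)" "F (map dual (take r w) @ map (isotropic j) s) \<noteq> 0" ..
    from excess_bound[OF F w True least r this] show ?thesis by (simp add: excess_def)
  next
    case False
    then have "Suc j \<notin> set (take r w)" using w set_take_subset[of r w] by (auto simp: words_def)
    then show ?thesis by simp
  qed
  have "lattice_word w"
    unfolding lattice_word_def
  proof (intro allI)
    fix r j
    have "take (min r n) w = take r w" using len by (simp add: min_def)
    with bound[of "min r n" j] show "count_list (take r w) (Suc j) \<le> count_list (take r w) j" by simp
  qed
  with invariant_same_parity[OF F w nz] w show ?thesis by (simp add: good_words_def)
qed

end

section \<open>Tensors given by formulas\<close>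

text \<open>Functions that are multilinear in the slots \<open>P\<close> of a list of functionals and do not look at the
  other slots, presented as combinations of products of evaluations. Naming the slots of each factor
  makes it possible to multiply forms in disjoint sets of slots, however these interleave.\<close>

inductive slot_form :: "nat set \<Rightarrow> (('v \<Rightarrow> complex) list \<Rightarrow> complex) \<Rightarrow> bool" for P where
  eval: "slot_form P (\<lambda>\<phi>s. \<Prod>p\<in>P. (\<phi>s ! p) (x p))"
| zero: "slot_form P (\<lambda>\<phi>s. 0)"
| combine: "slot_form P G \<Longrightarrow> slot_form P H \<Longrightarrow> slot_form P (\<lambda>\<phi>s. c * G \<phi>s + H \<phi>s)"

lemma slot_form_sum:
  assumes "finite A" "\<And>a. a \<in> A \<Longrightarrow> slot_form P (G a)"
  shows "slot_form P (\<lambda>\<phi>s. \<Sum>a\<in>A. c a * G a \<phi>s)"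
  using assms
proof (induction A)
  case (insert a A)
  then have "slot_form P (\<lambda>\<phi>s. c a * G a \<phi>s + (\<Sum>a\<in>A. c a * G a \<phi>s))"
    by (intro slot_form.combine) auto
  with insert show ?case by simp
qed (simp add: slot_form.zero)

lemma slot_form_mult:
  assumes "slot_form P G" "slot_form Q H" "P \<inter> Q = {}" "finite P" "finite Q"
  shows "slot_form (P \<union> Q) (\<lambda>\<phi>s. G \<phi>s * H \<phi>s)"
  using assms(1)
proof induction
  case (eval x)
  show ?case using assms(2)
  proof induction
    case (eval y)
    have "(\<Prod>p\<in>P. (\<phi>s ! p) (x p)) * (\<Prod>p\<in>Q. (\<phi>s ! p) (y p)) =
      (\<Prod>p\<in>P \<union> Q. (\<phi>s ! p) (if p \<in> P then x p else y p))" for \<phi>s :: "('a \<Rightarrow> complex) list"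
    proof -
      have "(\<Prod>p\<in>Q. (\<phi>s ! p) (y p)) = (\<Prod>p\<in>Q. (\<phi>s ! p) (if p \<in> P then x p else y p))"
        using assms(3) by (intro prod.cong) auto
      then show ?thesis using assms(3-5) by (simp add: prod.union_disjoint)
    qed
    then show ?case by (simp only: slot_form.eval)
  next
    case zero
    show ?case by (simp add: slot_form.zero)
  next
    case (combine G H c)
    from slot_form.combine[OF combine.IH, of c] show ?case by (simp add: algebra_simps)
  qed
next
  case zero
  show ?case by (simp add: slot_form.zero)
next
  case (combine G H c)
  from slot_form.combine[OF combine.IH, of c] show ?case by (simp add: algebra_simps)
qed

lemma slot_form_prod:
  assumes "finite A" "\<And>a. a \<in> A \<Longrightarrow> slot_form (P a) (G a)" "\<And>a. a \<in> A \<Longrightarrow> finite (P a)"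
    and "\<And>a b. a \<in> A \<Longrightarrow> b \<in> A \<Longrightarrow> a \<noteq> b \<Longrightarrow> P a \<inter> P b = {}"
  shows "slot_form (\<Union>a\<in>A. P a) (\<lambda>\<phi>s. \<Prod>a\<in>A. G a \<phi>s)"
  using assms
proof (induction A)
  case empty
  show ?case using slot_form.eval[of "{}"] by simp
next
  case (insert a A)
  have "slot_form (P a \<union> (\<Union>a\<in>A. P a)) (\<lambda>\<phi>s. G a \<phi>s * (\<Prod>a\<in>A. G a \<phi>s))"
  proof (intro slot_form_mult insert.IH)
    have "P a \<inter> P b = {}" if "b \<in> A" for b
      using insert.hyps(2) that by (intro insert.prems(3)) auto
    then show "P a \<inter> (\<Union>a\<in>A. P a) = {}" by blast
  qed (use insert in auto)
  with insert show ?case by simp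
qed

context orthonormal_basis
begin

interpretation T: vector_space "tensor_scale :: complex \<Rightarrow> ('v, complex) tensor \<Rightarrow> ('v, complex) tensor"
  by (rule vector_space_tensor_scale)

definition slot_tensor :: "nat \<Rightarrow> (('v \<Rightarrow> complex) list \<Rightarrow> complex) \<Rightarrow> ('v, complex) tensor" where
  "slot_tensor n G = (\<lambda>\<phi>s. if length \<phi>s = n \<and> (\<forall>\<phi>\<in>set \<phi>s. linear_functional \<phi>) then G \<phi>s else 0)"

lemma slot_tensor_in_tensor_power:
  assumes "slot_form {..<n} G"
  shows "slot_tensor n G \<in> tensor_power scale n"
  using assms
proof induction
  case (eval x)
  have "slot_tensor n (\<lambda>\<phi>s. \<Prod>p<n. (\<phi>s ! p) (x p)) = pure_tensor scale (map x [0..<n])"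
    by (rule ext) (simp add: slot_tensor_def pure_tensor_def)
  moreover have "pure_tensor scale (map x [0..<n]) \<in> tensor_power scale n"
    unfolding tensor_power_def by (intro T.span_base CollectI exI[of _ "map x [0..<n]"]) simp
  ultimately show ?case by simp
next
  case zero
  have "slot_tensor n (\<lambda>\<phi>s. 0) = (0 :: ('v, complex) tensor)" by (rule ext) (simp add: slot_tensor_def)
  then show ?case unfolding tensor_power_def by (simp only: T.span_zero)
next
  case (combine G H c)
  have "slot_tensor n (\<lambda>\<phi>s. c * G \<phi>s + H \<phi>s) = tensor_scale c (slot_tensor n G) + slot_tensor n H"
    by (rule ext) (simp add: slot_tensor_def tensor_scale_def)
  moreover have "tensor_scale c (slot_tensor n G) + slot_tensor n H \<in> tensor_power scale n"
    using combine.IH unfolding tensor_power_def by (intro T.span_add T.span_scale)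
  ultimately show ?case by metis
qed

lemma slot_tensor_invariant:
  assumes "slot_form {..<n} G"
    and invariant: "\<And>g \<phi>s. isometry g \<Longrightarrow> det (basis_matrix g) = 1 \<Longrightarrow> length \<phi>s = n \<Longrightarrow>
      (\<And>p. p < n \<Longrightarrow> linear_functional (\<phi>s ! p)) \<Longrightarrow> G (map (\<lambda>\<phi>. \<phi> \<circ> g) \<phi>s) = G \<phi>s"
  shows "slot_tensor n G \<in> invariants n"
  unfolding tensor_invariants_def
proof (intro CollectI conjI ballI)
  fix g assume "g \<in> special_orthogonal_group scale \<beta>"
  then have g: "isometry g" "det (basis_matrix g) = 1"
    by (simp_all add: special_orthogonal_isometry)
  then have lin: "linear_functional (\<phi> \<circ> g) \<longleftrightarrow> linear_functional \<phi>" for \<phi>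
    by (intro linear_functional_comp) (simp_all add: isometry_def)
  show "tensor_map g (slot_tensor n G) = slot_tensor n G"
  proof
    fix \<phi>s
    show "tensor_map g (slot_tensor n G) \<phi>s = slot_tensor n G \<phi>s"
      using invariant[OF g, of \<phi>s] by (simp add: tensor_map_def slot_tensor_def lin)
  qed
qed (rule slot_tensor_in_tensor_power[OF assms(1)])

section \<open>Contractions and determinants as invariants\<close>

text \<open>The form on the dual space that corresponds to \<open>\<beta>\<close>.\<close>

definition contract :: "('v \<Rightarrow> complex) \<Rightarrow> ('v \<Rightarrow> complex) \<Rightarrow> complex" where
  "contract \<phi> \<psi> = (\<Sum>i<k. \<phi> (e i) * \<psi> (e i))"

definition slot_det :: "(nat \<Rightarrow> nat) \<Rightarrow> ('v \<Rightarrow> complex) list \<Rightarrow> complex" where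
  "slot_det s \<phi>s = det (mat k k (\<lambda>(i, j). (\<phi>s ! s i) (e j)))"

lemma functional_isometry_expansion:
  assumes "linear_functional \<phi>"
  shows "\<phi> (g x) = (\<Sum>l<k. \<phi> (e l) * \<beta> (g x) (e l))"
  using fun_cong[OF functional_expansion[OF assms], of "g x"] by simp

lemma contract_isometry:
  assumes g: "isometry g" and lin: "linear_functional \<phi>" "linear_functional \<psi>"
  shows "contract (\<phi> \<circ> g) (\<psi> \<circ> g) = contract \<phi> \<psi>"
proof -
  have 1: "(\<Sum>i<k. \<beta> (g (e i)) (e l) * \<beta> (g (e i)) (e m)) = (if l = m then 1 else 0)"
    if lm: "l < k" "m < k" for l m
  proof -
    have "(basis_matrix g * (basis_matrix g)\<^sup>T) $$ (l, m) = 1\<^sub>m k $$ (l, m)"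
      by (simp add: basis_matrix_isometry[OF g])
    then show ?thesis using lm
      by (simp add: basis_matrix_def scalar_prod_def atLeast0LessThan)
  qed
  have "contract (\<phi> \<circ> g) (\<psi> \<circ> g) =
    (\<Sum>i<k. (\<Sum>l<k. \<phi> (e l) * \<beta> (g (e i)) (e l)) * (\<Sum>m<k. \<psi> (e m) * \<beta> (g (e i)) (e m)))"
    unfolding contract_def comp_def
    by (intro sum.cong refl arg_cong2[of _ _ _ _ "(*)"]
        functional_isometry_expansion[OF lin(1)] functional_isometry_expansion[OF lin(2)])
  also have "\<dots> = (\<Sum>i<k. \<Sum>l<k. \<Sum>m<k. \<phi> (e l) * \<psi> (e m) * (\<beta> (g (e i)) (e l) * \<beta> (g (e i)) (e m)))"
    by (simp add: sum_product mult_ac)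
  also have "\<dots> = (\<Sum>l<k. \<Sum>m<k. \<Sum>i<k. \<phi> (e l) * \<psi> (e m) * (\<beta> (g (e i)) (e l) * \<beta> (g (e i)) (e m)))"
    by (rule trans[OF sum.swap]) (intro sum.cong refl sum.swap)
  also have "\<dots> = (\<Sum>l<k. \<Sum>m<k. \<phi> (e l) * \<psi> (e m) * (if l = m then 1 else 0))"
    by (intro sum.cong refl) (simp add: sum_distrib_left[symmetric] 1)
  also have "\<dots> = contract \<phi> \<psi>" by (simp add: contract_def if_distrib cong: if_cong)
  finally show ?thesis .
qed

lemma slot_form_contract:
  assumes "p \<noteq> q"
  shows "slot_form {p, q} (\<lambda>\<phi>s. contract (\<phi>s ! p) (\<phi>s ! q))"
proof -
  have "slot_form {p, q} (\<lambda>\<phi>s. \<Sum>i<k. 1 * (\<Prod>r\<in>{p, q}. (\<phi>s ! r) (e i)))"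
    by (intro slot_form_sum slot_form.eval) simp
  with assms show ?thesis by (simp add: contract_def)
qed

lemma slot_form_det:
  assumes s: "inj_on s {..<k}"
  shows "slot_form (s ` {..<k}) (slot_det s)"
proof -
  have "slot_form (s ` {..<k}) (\<lambda>\<phi>s. \<Sum>\<pi> | \<pi> permutes {0..<k}. of_int (sign \<pi>) *
      (\<Prod>p\<in>s ` {..<k}. (\<phi>s ! p) (e (\<pi> (inv_into {..<k} s p)))))"
    by (intro slot_form_sum slot_form.eval finite_permutations) simp
  also have "(\<lambda>\<phi>s. \<Sum>\<pi> | \<pi> permutes {0..<k}. of_int (sign \<pi>) *
      (\<Prod>p\<in>s ` {..<k}. (\<phi>s ! p) (e (\<pi> (inv_into {..<k} s p))))) = slot_det s"
  proof
    fix \<phi>s :: "('v \<Rightarrow> complex) list"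
    have "(\<Prod>p\<in>s ` {..<k}. (\<phi>s ! p) (e (\<pi> (inv_into {..<k} s p)))) =
      (\<Prod>i = 0..<k. mat k k (\<lambda>(i, j). (\<phi>s ! s i) (e j)) $$ (i, \<pi> i))"
      if "\<pi> permutes {0..<k}" for \<pi>
      using s permutes_in_image[OF that]
      by (simp add: prod.reindex atLeast0LessThan)
    then show "(\<Sum>\<pi> | \<pi> permutes {0..<k}. of_int (sign \<pi>) *
      (\<Prod>p\<in>s ` {..<k}. (\<phi>s ! p) (e (\<pi> (inv_into {..<k} s p))))) = slot_det s \<phi>s"
      by (simp add: slot_det_def det_def'[of _ k])
  qed
  finally show ?thesis .
qed

lemma slot_det_isometry:
  assumes det: "det (basis_matrix g) = 1"
    and s: "\<And>i. i < k \<Longrightarrow> s i < length \<phi>s \<and> linear_functional (\<phi>s ! s i)"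
  shows "slot_det s (map (\<lambda>\<phi>. \<phi> \<circ> g) \<phi>s) = slot_det s \<phi>s"
proof -
  let ?A = "mat k k (\<lambda>(i, j). (\<phi>s ! s i) (e j))"
  have "mat k k (\<lambda>(i, j). (map (\<lambda>\<phi>. \<phi> \<circ> g) \<phi>s ! s i) (e j)) = ?A * basis_matrix g"
  proof (rule eq_matI)
    fix i j assume "i < dim_row (?A * basis_matrix g)" "j < dim_col (?A * basis_matrix g)"
    then have "i < k" "j < k" by (simp_all add: basis_matrix_def)
    then show "mat k k (\<lambda>(i, j). (map (\<lambda>\<phi>. \<phi> \<circ> g) \<phi>s ! s i) (e j)) $$ (i, j) = (?A * basis_matrix g) $$ (i, j)"
      using functional_isometry_expansion[of "\<phi>s ! s i" g "e j"] s[of i]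
      by (simp add: basis_matrix_def scalar_prod_def atLeast0LessThan)
  qed (simp_all add: basis_matrix_def)
  then show ?thesis
    unfolding slot_det_def using det_mult[of ?A k "basis_matrix g"] det
    by (simp add: basis_matrix_carrier)
qed

end

section \<open>The invariant of a lattice word\<close>

text \<open>The Young diagram of a good word has only even rows or only odd ones. Leave out its first column in
  the odd case, when it has full length \<open>k\<close>, and pair the remaining columns. Both columns of
  a pair have the same length. The wanted invariant contracts each cell of a right column with the
  cell to its left, antisymmetrizes over the right columns, and takes the determinant of the first
  column in the odd case.\<close>

locale paired_word =
  fixes k n :: nat and w :: "nat list"
  assumes good: "w \<in> good_words k n"
begin

text \<open>The number of unpaired columns. For \<open>k = 0\<close>, where both parities hold, it is \<open>0\<close>.\<close>

definition offset :: nat where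
  "offset = (if \<forall>i<k. even (count_list w i) then 0 else 1)"

definition right_cells :: "nat set" where
  "right_cells = {p. p < n \<and> offset < column w p \<and> odd (column w p + offset)}"

definition left_cell :: "nat \<Rightarrow> nat" where
  "left_cell p = cell_position w (w ! p) (column w p - 1)"

definition first_cell :: "nat \<Rightarrow> nat" where
  "first_cell i = cell_position w i 0"

definition column_perms :: "(nat \<Rightarrow> nat) set" where
  "column_perms = {\<sigma>. \<sigma> permutes right_cells \<and> (\<forall>p\<in>right_cells. column w (\<sigma> p) = column w p)}"

lemma word_facts: "lattice_word w" "w \<in> words k n" "length w = n" "p < n \<Longrightarrow> w ! p < k"
proof -
  show lattice: "lattice_word w" and w: "w \<in> words k n" using good by (simp_all add: good_words_def)
  show "length w = n" "p < n \<Longrightarrow> w ! p < k" by (rule wordsD[OF w])+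
qed

lemma even_count_offset: "i < k \<Longrightarrow> even (count_list w i + offset)"
  using good by (auto simp: good_words_def same_parity_word_def offset_def)

lemma finite_right_cells: "finite right_cells"
  by (simp add: right_cells_def)

lemma finite_column_perms: "finite column_perms"
  by (rule finite_subset[OF _ finite_permutations[OF finite_right_cells]]) (auto simp: column_perms_def)

lemma column_bound: "p < n \<Longrightarrow> column w p < count_list w (w ! p)"
  using column_less_count[of p n w] word_facts by simp

lemma left_cell:
  assumes "p \<in> right_cells"
  shows "left_cell p < n" "w ! left_cell p = w ! p" "Suc (column w (left_cell p)) = column w p"
proof -
  have p: "p < n" "0 < column w p" using assms by (auto simp: right_cells_def)
  then have "column w p - 1 < count_list w (w ! p)" using column_bound[of p] by simp
  from cell_position[OF this] p(2)
  show "left_cell p < n" "w ! left_cell p = w ! p" "Suc (column w (left_cell p)) = column w p"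
    by (simp_all add: left_cell_def word_facts)
qed

lemma left_cell_not_right:
  assumes "p \<in> right_cells"
  shows "left_cell p \<notin> right_cells" "offset \<le> column w (left_cell p)"
  using assms left_cell(3)[OF assms, symmetric] by (simp_all add: right_cells_def)

lemma inj_left_cell: "inj_on left_cell right_cells"
proof (rule inj_onI)
  fix p q assume pq: "p \<in> right_cells" "q \<in> right_cells" "left_cell p = left_cell q"
  then have "w ! p = w ! q" "column w p = column w q"
    using left_cell[OF pq(1)] left_cell[OF pq(2)] by auto
  with pq show "p = q" using cell_inj[of p w q] word_facts(3) by (auto simp: right_cells_def)
qed

text \<open>A left cell is not the last one of its row, because its row has an even number of paired cells.\<close>

lemma left_cell_surj:
  assumes p: "p < n" "offset \<le> column w p" "p \<notin> right_cells"
  shows "\<exists>q\<in>right_cells. left_cell q = p"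
proof -
  have "even (column w p + offset)"
    using p by (cases "offset = column w p") (auto simp: right_cells_def)
  moreover have "even (count_list w (w ! p) + offset)"
    by (rule even_count_offset[OF word_facts(4)[OF p(1)]])
  ultimately have "count_list w (w ! p) \<noteq> Suc (column w p)" by auto
  then have "Suc (column w p) < count_list w (w ! p)" using column_bound[OF p(1)] by simp
  from cell_position[OF this] obtain q where q: "q < n" "w ! q = w ! p" "column w q = Suc (column w p)"
    using word_facts by auto
  have "left_cell q = p" using q p cell_position_cell[of p w] by (simp add: left_cell_def word_facts)
  moreover have "q \<in> right_cells"
    using q p(2) \<open>even (column w p + offset)\<close> by (simp add: right_cells_def)
  ultimately show ?thesis by blast
qed

lemma first_cell:
  assumes "i < k" "offset = 1"
  shows "first_cell i < n" "w ! first_cell i = i" "column w (first_cell i) = 0"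
proof -
  have "odd (count_list w i)" using even_count_offset[OF assms(1)] assms(2) by simp
  then have "0 < count_list w i" by (rule odd_pos)
  from cell_position[OF this]
  show "first_cell i < n" "w ! first_cell i = i" "column w (first_cell i) = 0"
    by (simp_all add: first_cell_def word_facts)
qed

lemma inj_first_cell: "offset = 1 \<Longrightarrow> inj_on first_cell {..<k}"
  by (metis first_cell(2) inj_onI lessThan_iff)

lemma first_cell_column:
  assumes "p < n" "column w p = 0"
  shows "first_cell (w ! p) = p"
  using cell_position_cell[of p w] assms by (simp add: first_cell_def word_facts)

lemma offset_cases: "offset = 0 \<or> offset = 1" by (simp add: offset_def)

lemma cells_cover:
  "{..<n} = (if offset = 0 then {} else first_cell ` {..<k}) \<union> (right_cells \<union> left_cell ` right_cells)"
proof (intro equalityI subsetI)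
  fix p assume "p \<in> {..<n}"
  then have p: "p < n" by simp
  show "p \<in> (if offset = 0 then {} else first_cell ` {..<k}) \<union> (right_cells \<union> left_cell ` right_cells)"
  proof (cases "column w p < offset")
    case True
    then have "column w p = 0" "offset = 1" using offset_cases by auto
    with first_cell_column[OF p] word_facts(4)[OF p] show ?thesis by force
  next
    case False
    with left_cell_surj[OF p] show ?thesis by force
  qed
qed (use left_cell first_cell offset_cases in \<open>auto simp: right_cells_def split: if_splits\<close>)

lemma first_cells_disjoint:
  "offset = 1 \<Longrightarrow> first_cell ` {..<k} \<inter> (right_cells \<union> left_cell ` right_cells) = {}"
  using first_cell(3) left_cell_not_right(2) by (fastforce simp: right_cells_def)

text \<open>The coordinate at the word \<open>u\<close> of the antisymmetrized product of contractions.\<close>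

definition pairing_coeff :: "nat list \<Rightarrow> complex" where
  "pairing_coeff u = (\<Sum>\<sigma>\<in>column_perms. of_int (sign \<sigma>) *
     (\<Prod>p\<in>right_cells. if u ! \<sigma> p = u ! left_cell p then 1 else 0))"

lemma column_permsD:
  assumes "\<sigma> \<in> column_perms"
  shows "\<sigma> permutes right_cells" "p \<in> right_cells \<Longrightarrow> \<sigma> p \<in> right_cells"
    "p \<in> right_cells \<Longrightarrow> column w (\<sigma> p) = column w p"
  using assms permutes_in_image[of \<sigma> right_cells p] by (auto simp: column_perms_def)

text \<open>In a nonzero term the permutation preserves rows as well as columns, so it is the identity.\<close>

lemma pairing_coeff_self: "pairing_coeff w = 1"
proof -
  have "(\<Prod>p\<in>right_cells. if w ! \<sigma> p = w ! left_cell p then 1 else 0) = (if \<sigma> = id then 1 else 0 :: complex)"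
    if \<sigma>: "\<sigma> \<in> column_perms" for \<sigma>
  proof (cases "\<forall>p\<in>right_cells. w ! \<sigma> p = w ! left_cell p")
    case True
    have "\<sigma> p = p" for p
    proof (cases "p \<in> right_cells")
      case p: True
      then show ?thesis
        using True column_permsD(2,3)[OF \<sigma> p] left_cell(2)[OF p] cell_inj[of "\<sigma> p" w p] word_facts(3)
        by (auto simp: right_cells_def)
    next
      case False
      then show ?thesis using column_permsD(1)[OF \<sigma>] by (simp add: permutes_not_in)
    qed
    with True show ?thesis by auto
  next
    case False
    then have "(\<Prod>p\<in>right_cells. if w ! \<sigma> p = w ! left_cell p then 1 else 0) = (0 :: complex)"
      using finite_right_cells by (intro prod_zero) auto
    moreover have "\<sigma> \<noteq> id" using False left_cell(2) by auto
    ultimately show ?thesis by simp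
  qed
  then have "pairing_coeff w = (\<Sum>\<sigma>\<in>column_perms. if \<sigma> = id then 1 else 0)"
    unfolding pairing_coeff_def by (intro sum.cong) auto
  also have "\<dots> = 1"
    using finite_column_perms by (simp add: column_perms_def permutes_id[unfolded id_def] permutes_id)
  finally show ?thesis .
qed

text \<open>Composing with the transposition of two equal letters in a right column changes the sign of every
  term but not the sum.\<close>

lemma pairing_coeff_right_injective:
  assumes nz: "pairing_coeff u \<noteq> 0"
    and pq: "p \<in> right_cells" "q \<in> right_cells" "column w p = column w q" "u ! p = u ! q"
  shows "p = q"
proof (rule ccontr)
  assume "p \<noteq> q"
  define \<tau> where "\<tau> = transpose p q"
  have u\<tau>: "u ! \<tau> r = u ! r" for r using pq(4) by (auto simp: \<tau>_def transpose_def)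
  have c\<tau>: "column w (\<tau> r) = column w r" for r using pq(3) by (auto simp: \<tau>_def transpose_def)
  have \<tau>: "\<tau> permutes right_cells" unfolding \<tau>_def using pq by (intro permutes_swap_id)
  have \<tau>\<tau>: "\<tau> \<circ> (\<tau> \<circ> \<sigma>) = \<sigma>" for \<sigma> by (simp add: \<tau>_def fun_eq_iff)
  have mem: "\<tau> \<circ> \<sigma> \<in> column_perms" if "\<sigma> \<in> column_perms" for \<sigma>
    using column_permsD[OF that] c\<tau> \<tau> by (auto simp: column_perms_def intro: permutes_compose)
  have sgn: "sign (\<tau> \<circ> \<sigma>) = - sign \<sigma>" if "\<sigma> \<in> column_perms" for \<sigma>
  proof -
    have "permutation \<sigma>" "permutation \<tau>"
      using column_permsD(1)[OF that] \<tau> finite_right_cells by (auto simp: permutation_permutes)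
    then have "sign (\<tau> \<circ> \<sigma>) = sign \<tau> * sign \<sigma>" by (intro sign_compose)
    then show ?thesis using \<open>p \<noteq> q\<close> by (simp add: \<tau>_def sign_swap_id)
  qed
  have "pairing_coeff u = (\<Sum>\<sigma>\<in>column_perms. of_int (sign (\<tau> \<circ> \<sigma>)) *
     (\<Prod>p\<in>right_cells. if u ! (\<tau> \<circ> \<sigma>) p = u ! left_cell p then 1 else 0))"
    unfolding pairing_coeff_def
    by (rule sum.reindex_bij_witness[of _ "(\<circ>) \<tau>" "(\<circ>) \<tau>"]) (auto simp: \<tau>\<tau> mem)
  also have "\<dots> = (\<Sum>\<sigma>\<in>column_perms. - (of_int (sign \<sigma>) *
     (\<Prod>p\<in>right_cells. if u ! \<sigma> p = u ! left_cell p then 1 else 0)))"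
    by (intro sum.cong refl) (simp add: sgn u\<tau>)
  also have "\<dots> = - pairing_coeff u" by (simp add: pairing_coeff_def sum_negf)
  finally show False using nz by simp
qed

text \<open>In left columns injectivity follows too: a nonzero term matches each left cell with a cell of the
  right column that carries the same letter.\<close>

lemma pairing_coeff_injective:
  assumes nz: "pairing_coeff u \<noteq> 0"
    and pq: "p < n" "q < n" "column w p = column w q" "u ! p = u ! q" and off: "offset \<le> column w p"
  shows "p = q"
proof (cases "p \<in> right_cells")
  case True
  with pq have "q \<in> right_cells" by (auto simp: right_cells_def)
  with pairing_coeff_right_injective[OF nz True] pq show ?thesis by simp
next
  case False
  with pq have "q \<notin> right_cells" by (auto simp: right_cells_def)
  with False obtain p' q' where p': "p' \<in> right_cells" "left_cell p' = p"
    and q': "q' \<in> right_cells" "left_cell q' = q"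
    using left_cell_surj pq off by metis
  obtain \<sigma> where \<sigma>: "\<sigma> \<in> column_perms"
    "(\<Prod>p\<in>right_cells. if u ! \<sigma> p = u ! left_cell p then 1 else 0 :: complex) \<noteq> 0"
    using nz unfolding pairing_coeff_def by (metis (no_types, lifting) mult_zero_right sum.neutral)
  then have eq: "u ! \<sigma> r = u ! left_cell r" if "r \<in> right_cells" for r
    using that finite_right_cells by (auto split: if_splits)
  have "column w p' = column w q'"
    using left_cell(3)[OF p'(1)] left_cell(3)[OF q'(1)] p' q' pq by simp
  then have "\<sigma> p' = \<sigma> q'"
    using pairing_coeff_right_injective[OF nz, of "\<sigma> p'" "\<sigma> q'"] column_permsD[OF \<sigma>(1)] p' q' eq pq by auto
  then have "p' = q'" using permutes_inj[OF column_permsD(1)[OF \<sigma>(1)]] by (simp add: inj_eq)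
  with p' q' show ?thesis by simp
qed

end

locale word_invariant = orthonormal_basis scale \<beta> e k + paired_word k n w
  for scale :: "complex \<Rightarrow> 'v::ab_group_add \<Rightarrow> 'v" and \<beta> e k n w
begin

definition word_form :: "('v \<Rightarrow> complex) list \<Rightarrow> complex" where
  "word_form \<phi>s = (if offset = 0 then 1 else slot_det first_cell \<phi>s) *
     (\<Sum>\<sigma>\<in>column_perms. of_int (sign \<sigma>) *
        (\<Prod>p\<in>right_cells. contract (\<phi>s ! \<sigma> p) (\<phi>s ! left_cell p)))"

lemma slot_form_word_form: "slot_form {..<n} word_form"
proof -
  let ?D = "if offset = 0 then {} else first_cell ` {..<k}"
  let ?R = "right_cells \<union> left_cell ` right_cells"
  have head: "slot_form ?D (\<lambda>\<phi>s. if offset = 0 then 1 else slot_det first_cell \<phi>s)"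
  proof (cases "offset = 0")
    case True
    then show ?thesis using slot_form.eval[of "{}"] by simp
  next
    case False
    then show ?thesis using offset_cases by (simp add: slot_form_det inj_first_cell)
  qed
  have pairs: "slot_form ?R (\<lambda>\<phi>s. \<Prod>p\<in>right_cells. contract (\<phi>s ! \<sigma> p) (\<phi>s ! left_cell p))"
    if \<sigma>: "\<sigma> \<in> column_perms" for \<sigma>
  proof -
    have inj: "\<sigma> p = \<sigma> q \<longleftrightarrow> p = q" for p q
      using permutes_inj[OF column_permsD(1)[OF \<sigma>]] by (simp add: inj_eq)
    have ne: "\<sigma> p \<noteq> left_cell q" if "p \<in> right_cells" "q \<in> right_cells" for p q
      using column_permsD(2)[OF \<sigma> that(1)] left_cell_not_right(1)[OF that(2)] by auto
    have "slot_form (\<Union>p\<in>right_cells. {\<sigma> p, left_cell p})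
        (\<lambda>\<phi>s. \<Prod>p\<in>right_cells. contract (\<phi>s ! \<sigma> p) (\<phi>s ! left_cell p))"
    proof (rule slot_form_prod[OF finite_right_cells])
      show "{\<sigma> p, left_cell p} \<inter> {\<sigma> q, left_cell q} = {}"
        if "p \<in> right_cells" "q \<in> right_cells" "p \<noteq> q" for p q
        using that ne[of p q] ne[of q p] inj inj_onD[OF inj_left_cell, of p q] by auto
    qed (simp_all add: slot_form_contract ne)
    moreover have "(\<Union>p\<in>right_cells. {\<sigma> p, left_cell p}) = \<sigma> ` right_cells \<union> left_cell ` right_cells"
      by auto
    ultimately show ?thesis using permutes_image[OF column_permsD(1)[OF \<sigma>]] by simp
  qed
  have "slot_form (?D \<union> ?R) word_form"
    unfolding word_form_def
  proof (rule slot_form_mult[OF head])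
    show "?D \<inter> ?R = {}" using first_cells_disjoint offset_cases by auto
  qed (use finite_right_cells finite_column_perms pairs in \<open>auto intro!: slot_form_sum\<close>)
  then show ?thesis using cells_cover by simp
qed

lemma word_form_isometry:
  assumes g: "isometry g" "det (basis_matrix g) = 1" and len: "length \<phi>s = n"
    and lin: "\<And>p. p < n \<Longrightarrow> linear_functional (\<phi>s ! p)"
  shows "word_form (map (\<lambda>\<phi>. \<phi> \<circ> g) \<phi>s) = word_form \<phi>s"
proof -
  have "contract (map (\<lambda>\<phi>. \<phi> \<circ> g) \<phi>s ! \<sigma> p) (map (\<lambda>\<phi>. \<phi> \<circ> g) \<phi>s ! left_cell p) =
      contract (\<phi>s ! \<sigma> p) (\<phi>s ! left_cell p)"
    if "\<sigma> \<in> column_perms" "p \<in> right_cells" for \<sigma> p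
  proof -
    have "\<sigma> p < n" "left_cell p < n"
      using column_permsD(2)[OF that] left_cell(1)[OF that(2)] by (auto simp: right_cells_def)
    then show ?thesis using len lin contract_isometry[OF g(1)] by simp
  qed
  moreover have "slot_det first_cell (map (\<lambda>\<phi>. \<phi> \<circ> g) \<phi>s) = slot_det first_cell \<phi>s"
    if "offset \<noteq> 0"
    using that first_cell(1) lin len offset_cases by (intro slot_det_isometry[OF g(2)]) auto
  ultimately show ?thesis by (simp add: word_form_def)
qed

definition invariant :: "('v, complex) tensor" where
  "invariant = slot_tensor n word_form"

lemma invariant_mem: "invariant \<in> invariants n"
  unfolding invariant_def
proof (rule slot_tensor_invariant[OF slot_form_word_form])
  fix g :: "'v \<Rightarrow> 'v" and \<phi>s :: "('v \<Rightarrow> complex) list"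
  assume g: "isometry g" "det (basis_matrix g) = 1" "length \<phi>s = n"
    and lin: "\<And>p. p < n \<Longrightarrow> linear_functional (\<phi>s ! p)"
  show "word_form (map (\<lambda>\<phi>. \<phi> \<circ> g) \<phi>s) = word_form \<phi>s" by (rule word_form_isometry[OF g]) (rule lin)
qed

lemma contract_dual: "a < k \<Longrightarrow> b < k \<Longrightarrow> contract (dual a) (dual b) = (if a = b then 1 else 0)"
proof -
  assume ab: "a < k" "b < k"
  have "contract (dual a) (dual b) = (\<Sum>i<k. \<beta> (e a) (e i) * \<beta> (e b) (e i))"
    unfolding contract_def by (intro sum.cong refl arg_cong2[of _ _ _ _ "(*)"] beta_sym)
  also have "\<dots> = \<beta> (e a) (e b)" by (rule beta_expansion[symmetric])
  finally show ?thesis using orthonormal[OF ab] by simp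
qed

lemma invariant_word:
  assumes u: "u \<in> words k n"
  shows "invariant (map dual u) =
    (if offset = 0 then 1 else slot_det first_cell (map dual u)) * pairing_coeff u"
proof -
  have len: "length u = n" using u by (simp add: words_def)
  have "contract (map dual u ! \<sigma> p) (map dual u ! left_cell p) = (if u ! \<sigma> p = u ! left_cell p then 1 else 0)"
    if "\<sigma> \<in> column_perms" "p \<in> right_cells" for \<sigma> p
  proof -
    have "\<sigma> p < n" "left_cell p < n"
      using column_permsD(2)[OF that] left_cell(1)[OF that(2)] by (auto simp: right_cells_def)
    then show ?thesis using len wordsD(2)[OF u] by (simp add: contract_dual)
  qed
  then have "word_form (map dual u) =
    (if offset = 0 then 1 else slot_det first_cell (map dual u)) * pairing_coeff u"
    by (simp add: word_form_def pairing_coeff_def)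
  then show ?thesis using len linear_dual by (auto simp: invariant_def slot_tensor_def)
qed

lemma invariant_self: "invariant (map dual w) = 1"
proof -
  have "slot_det first_cell (map dual w) = 1" if "offset \<noteq> 0"
  proof -
    have "mat k k (\<lambda>(i, j). (map dual w ! first_cell i) (e j)) = 1\<^sub>m k"
      using that offset_cases first_cell word_facts(3) orthonormal by (intro eq_matI) auto
    then show ?thesis by (simp add: slot_det_def)
  qed
  then show ?thesis using invariant_word[OF word_facts(2)] pairing_coeff_self by simp
qed

text \<open>The determinant of the unpaired column vanishes if a letter is repeated in it, since two of its rows
  are then equal; paired columns are covered by \<open>pairing_coeff_injective\<close>.\<close>

lemma invariant_least:
  assumes u: "u \<in> words k n" and nz: "invariant (map dual u) \<noteq> 0"
  shows "w \<le> u"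
proof (rule lattice_word_least_injective[OF word_facts(1)])
  have len: "length u = n" using u by (simp add: words_def)
  then show "length u = length w" by (simp add: word_facts)
  fix p q assume "p < length w" "q < length w" and eq: "column w p = column w q" "u ! p = u ! q"
  then have pq: "p < n" "q < n" by (simp_all add: word_facts)
  have nz1: "pairing_coeff u \<noteq> 0" and nz2: "offset \<noteq> 0 \<Longrightarrow> slot_det first_cell (map dual u) \<noteq> 0"
    using nz invariant_word[OF u] by auto
  show "p = q"
  proof (cases "offset \<le> column w p")
    case True
    then show ?thesis using pairing_coeff_injective[OF nz1 pq eq] by simp
  next
    case False
    then have 0: "column w p = 0" "column w q = 0" "offset = 1" using offset_cases eq by auto
    then have first: "first_cell (w ! p) = p" "first_cell (w ! q) = q"
      using first_cell_column pq by auto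
    show ?thesis
    proof (rule ccontr)
      assume "p \<noteq> q"
      then have "w ! p \<noteq> w ! q" using first by metis
      let ?A = "mat k k (\<lambda>(i, j). (map dual u ! first_cell i) (e j))"
      have "row ?A (w ! p) = row ?A (w ! q)"
        using word_facts(4) pq first eq len by (intro eq_vecI) auto
      then have "det ?A = 0"
        using \<open>w ! p \<noteq> w ! q\<close> word_facts(4) pq by (intro det_identical_rows[of _ k "w ! p" "w ! q"]) auto
      with nz2 0 show False by (simp add: slot_det_def)
    qed
  qed
qed

end

section \<open>A basis of the invariant tensors\<close>

context orthonormal_basis
begin

interpretation T: vector_space "tensor_scale :: complex \<Rightarrow> ('v, complex) tensor \<Rightarrow> ('v, complex) tensor"
  by (rule vector_space_tensor_scale)

definition word_tensor :: "nat \<Rightarrow> nat list \<Rightarrow> ('v, complex) tensor" where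
  "word_tensor n w = word_invariant.invariant scale e k n w"

lemma word_tensor:
  assumes "w \<in> good_words k n"
  shows "word_tensor n w \<in> invariants n" "word_tensor n w (map dual w) = 1"
    "u \<in> words k n \<Longrightarrow> word_tensor n w (map dual u) \<noteq> 0 \<Longrightarrow> w \<le> u"
proof -
  interpret word_invariant scale \<beta> e k n w
    by unfold_locales (rule assms)
  show "word_tensor n w \<in> invariants n" "word_tensor n w (map dual w) = 1"
    "u \<in> words k n \<Longrightarrow> word_tensor n w (map dual u) \<noteq> 0 \<Longrightarrow> w \<le> u"
    unfolding word_tensor_def using invariant_mem invariant_self invariant_least by auto
qed

lemma subspace_invariants: "T.subspace (invariants n)"
proof (rule T.subspaceI)
  show "0 \<in> invariants n"
    unfolding tensor_invariants_def tensor_power_def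
  proof (intro CollectI conjI ballI)
    show "tensor_map g 0 = 0" for g by (simp add: tensor_map_def fun_eq_iff)
  qed (rule T.span_zero)
next
  fix F G c assume F: "F \<in> invariants n" and G: "G \<in> invariants n"
  have "F + G \<in> tensor_power scale n" "tensor_scale c F \<in> tensor_power scale n"
    using F G unfolding tensor_invariants_def tensor_power_def
    by (auto simp only: mem_Collect_eq intro: T.span_add T.span_scale)
  moreover have "tensor_map g (F + G) = tensor_map g F + tensor_map g G"
    "tensor_map g (tensor_scale c F) = tensor_scale c (tensor_map g F)" for g
    by (simp_all add: tensor_map_def tensor_scale_def fun_eq_iff)
  ultimately show "F + G \<in> invariants n" "tensor_scale c F \<in> invariants n"
    using F G unfolding tensor_invariants_def by auto
qed

lemma good_word_word: "w \<in> good_words k n \<Longrightarrow> w \<in> words k n"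
  by (simp add: good_words_def)

lemma inj_word_tensor: "inj_on (word_tensor n) (good_words k n)"
proof (rule inj_onI)
  fix v w assume vw: "v \<in> good_words k n" "w \<in> good_words k n" "word_tensor n v = word_tensor n w"
  have "v \<le> w" by (rule word_tensor(3)[OF vw(1)]) (simp_all add: vw word_tensor good_word_word)
  moreover have "w \<le> v"
    by (rule word_tensor(3)[OF vw(2)]) (simp_all add: vw word_tensor good_word_word flip: vw(3))
  ultimately show "v = w" by simp
qed

text \<open>Evaluating a linear relation at the least word with nonzero coefficient isolates this coefficient.\<close>

lemma independent_word_tensor: "\<not> T.dependent (word_tensor n ` good_words k n)"
proof
  assume "T.dependent (word_tensor n ` good_words k n)"
  then obtain c v where v: "v \<in> good_words k n" "c (word_tensor n v) \<noteq> 0"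
    and sum: "(\<Sum>x\<in>word_tensor n ` good_words k n. tensor_scale (c x) x) = 0"
    using finite_good_words by (auto simp: T.dependent_finite)
  let ?A = "{w \<in> good_words k n. c (word_tensor n w) \<noteq> 0}"
  define w where "w = Min ?A"
  have fin: "finite ?A" using finite_good_words by simp
  have w: "w \<in> ?A" unfolding w_def using fin v by (intro Min_in) auto
  have sum0: "(\<Sum>v\<in>good_words k n. c (word_tensor n v) * word_tensor n v (map dual w)) = 0"
  proof -
    have ev: "(\<Sum>v\<in>A. tensor_scale (c (word_tensor n v)) (word_tensor n v)) \<phi>s =
        (\<Sum>v\<in>A. c (word_tensor n v) * word_tensor n v \<phi>s)" if "finite A" for A \<phi>s
      using that by induction (simp_all add: tensor_scale_def)
    show ?thesis
      using sum inj_word_tensor ev[OF finite_good_words, of k n "map dual w"]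
      by (simp add: sum.reindex)
  qed
  have "c (word_tensor n v) * word_tensor n v (map dual w) = (if v = w then c (word_tensor n w) else 0)"
    if v: "v \<in> good_words k n" for v
  proof (cases "c (word_tensor n v) = 0")
    case False
    then have "w \<le> v" unfolding w_def using fin v by (intro Min_le) auto
    then show ?thesis
      using word_tensor(3)[OF v, of w] word_tensor(2)[OF v] w good_word_word by force
  qed (use w in auto)
  then have "(\<Sum>v\<in>good_words k n. c (word_tensor n v) * word_tensor n v (map dual w)) =
      (\<Sum>v\<in>good_words k n. if v = w then c (word_tensor n w) else 0)"
    by (intro sum.cong) auto
  with sum0 w finite_good_words show False by simp
qed

text \<open>Gaussian elimination on least words. The least word of a nonzero invariant \<open>F\<close> is good, so a multiple
  of its word tensor can be subtracted from \<open>F\<close> to cancel that coordinate without creating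
  coordinates below it.\<close>

lemma invariants_spanned:
  assumes "F \<in> invariants n"
  shows "F \<in> T.span (word_tensor n ` good_words k n)"
proof -
  \<comment> \<open>the words from the least word of \<open>F\<close> on; this set shrinks in each step\<close>
  define up where "up F = {u \<in> words k n. \<exists>v\<in>words k n. v \<le> u \<and> F (map dual v) \<noteq> 0}"
    for F :: "('v, complex) tensor"
  show ?thesis using assms
  proof (induction "card (up F)" arbitrary: F rule: less_induct)
    case less
    have FT: "F \<in> tensor_power scale n" using less.prems by (simp add: tensor_invariants_def)
    let ?A = "{u \<in> words k n. F (map dual u) \<noteq> 0}"
    show ?case
    proof (cases "?A = {}")
      case True
      then have "F = 0" by (intro tensor_eq_0I[OF FT]) auto
      then show ?thesis by (simp add: T.span_zero)
    next
      case False
      define w where "w = Min ?A"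
      have fin: "finite ?A" using finite_words by simp
      have w: "w \<in> words k n" "F (map dual w) \<noteq> 0"
        using Min_in[OF fin False] by (auto simp: w_def)
      have w_le: "w \<le> u" if "u \<in> words k n" "F (map dual u) \<noteq> 0" for u
        unfolding w_def using that fin by (intro Min_le) auto
      have good: "w \<in> good_words k n"
        using w_le by (intro least_word_good[OF less.prems w]) force
      define F' where "F' = F - tensor_scale (F (map dual w)) (word_tensor n w)"
      have F': "F' \<in> invariants n" unfolding F'_def
        using subspace_invariants less.prems word_tensor(1)[OF good]
        by (intro T.subspace_diff T.subspace_scale)
      have F'_word: "F' (map dual u) = F (map dual u) - F (map dual w) * word_tensor n w (map dual u)" for u
        by (simp add: F'_def tensor_scale_def)
      have F'_least: "w < u" if u: "u \<in> words k n" "F' (map dual u) \<noteq> 0" for u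
      proof -
        have "F (map dual u) \<noteq> 0 \<or> word_tensor n w (map dual u) \<noteq> 0"
          using u(2) by (auto simp: F'_word)
        then have "w \<le> u" using w_le[OF u(1)] word_tensor(3)[OF good u(1)] by auto
        moreover have "u \<noteq> w" using u(2) word_tensor(2)[OF good] by (auto simp: F'_word)
        ultimately show ?thesis by simp
      qed
      have "up F' \<subset> up F"
      proof
        show "up F' \<subseteq> up F"
        proof
          fix u assume "u \<in> up F'"
          then obtain v where "u \<in> words k n" "v \<in> words k n" "v \<le> u" "F' (map dual v) \<noteq> 0"
            by (auto simp: up_def)
          with F'_least[of v] w have "w \<le> u" by (meson less_imp_le order_trans)
          with \<open>u \<in> words k n\<close> w show "u \<in> up F" unfolding up_def by blast
        qed
        have "w \<in> up F" unfolding up_def using w by blast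
        moreover have "w \<notin> up F'" unfolding up_def using F'_least by force
        ultimately show "up F' \<noteq> up F" by blast
      qed
      then have "card (up F') < card (up F)"
        by (intro psubset_card_mono) (simp add: up_def finite_words)
      then have "F' \<in> T.span (word_tensor n ` good_words k n)" using F' by (rule less.hyps)
      moreover have "tensor_scale (F (map dual w)) (word_tensor n w) \<in> T.span (word_tensor n ` good_words k n)"
        using good by (intro T.span_scale T.span_base) auto
      ultimately have "F' + tensor_scale (F (map dual w)) (word_tensor n w) \<in> T.span (word_tensor n ` good_words k n)"
        by (rule T.span_add)
      then show ?thesis by (simp add: F'_def)
    qed
  qed
qed

lemma dim_invariants: "T.dim (invariants n) = card (good_words k n)"
proof -
  have "T.span (word_tensor n ` good_words k n) = T.span (invariants n)"
  proof (rule antisym)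
    show "T.span (word_tensor n ` good_words k n) \<subseteq> T.span (invariants n)"
      using word_tensor(1) by (intro T.span_mono) auto
    show "T.span (invariants n) \<subseteq> T.span (word_tensor n ` good_words k n)"
      using invariants_spanned by (intro T.span_minimal) auto
  qed
  then have "T.dim (invariants n) = card (word_tensor n ` good_words k n)"
    by (rule T.dim_eq_card) (rule independent_word_tensor)
  then show ?thesis by (simp add: card_image inj_word_tensor)
qed

end

theorem corollary4p4p3:
  fixes scale :: "complex \<Rightarrow> 'v::ab_group_add \<Rightarrow> 'v"
    and Basis :: "'v set"
    and \<beta> :: "'v \<Rightarrow> 'v \<Rightarrow> complex"
    and k n :: nat
  assumes "finite_dimensional_vector_space scale Basis"
    and "vector_space.dim scale (UNIV :: 'v set) = k"
    and "bilinear_form scale \<beta>"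
    and "symmetric_form \<beta>"
    and "nondegenerate_form \<beta>"
  shows "vector_space.dim tensor_scale
           (tensor_invariants scale (special_orthogonal_group scale \<beta>) n) =
         (\<Sum>\<mu> | partition_of n \<mu> \<and> length \<mu> \<le> k \<and> rows_same_parity k \<mu>. card (SYT \<mu>))"
proof -
  obtain e where "orthonormal_basis scale \<beta> e k"
    using ex_orthonormal_basis[OF assms] by blast
  then interpret orthonormal_basis scale \<beta> e k .
  show ?thesis by (simp only: dim_invariants card_good_words)
qed

end
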